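(* For $d\ge1$, with $\tilde M_k=\tilde M_k^A$, $$\tilde M_d=\prod_{j=1}^{d-1}(1-st^j)+s\sum_{k=1}^{d-1}t^k{d\choose k}_q\left(\prod_{j=k+1}^{d-1}(1-st^j)\right)\tilde M_k,$$ $$\tilde M^\pm_d=\prod_{j=1}^d(1-st^j)+s\sum_{k=1}^dt^k\left(\prod_{j=0}^{k-1}\frac{1-q^{2d-2j}}{1-q^{k-j}}\right)\left(\prod_{j=k+1}^d(1-st^j)\right)\tilde M_k,$$ $$\tilde M^D_d=\prod_{j=1}^d(1-st^j)+s\sum_{k=1}^dt^k{d\choose k}_q\left(\sum_{l=0}^{\lfloor k/2\rfloor}{k\choose 2l}_qq^{l(2d+2l-2k-1)}\right)\left(\prod_{j=k+1}^d(1-st^j)\right)\tilde M_k,$$ where $\tilde M_d=\tilde M_d^A$, $\tilde M_d^\pm=\tilde M_d^{BC}$.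
   Context: Groups: $\mathcal S_d^A=\mathcal S_d$; $\mathcal S_d^{BC}=\mathcal S_d^\pm$, permutations $\sigma$ of $\{\pm1,\dots,\pm d\}$ with $\sigma(-i)=-\sigma(i)$; $\mathcal S_d^D\subset\mathcal S_d^\pm$, those with an even number of $i\in\{1,\dots,d\}$ with $\sigma(i)<0$. Let $\mathrm{Inv}(\sigma)=\#\{0<i<j\le d:\sigma(i)\sigma(j)(\sigma(i)-\sigma(j))>0\}$, $N(\sigma)=\{1\le i\le d:\sigma(i)<0\}$; $l^A=\mathrm{Inv}$, $l^{BC}(\sigma)=\mathrm{Inv}(\sigma)+\sum_{i\in N(\sigma)}(d+1+\sigma(i))$, $l^D(\sigma)=\mathrm{Inv}(\sigma)+\sum_{i\in N(\sigma)}(d+\sigma(i))$; $\mathrm{Wmaj}(\sigma)=\sum_{1\le i<d,\ \sigma(i)>\sigma(i+1)}i+|N(\sigma)|$ (usual order); $\beta(\sigma)=[\sigma(d)<0]+\#\{1\le i<d:\sigma(i)\sigma(i+1)(\sigma(i)-\sigma(i+1))>0\}$. Then $\tilde M_d^*=\sum_{\sigma\in\mathcal S_d^*}q^{l^*(\sigma)}s^{\beta(\sigma)}t^{\mathrm{Wmaj}(\sigma)}$ for $*\in\{A,BC,D\}$. $q$-binomials: ${n\choose0}_q={n\choose n}_q=1$, ${n\choose i}_q={n-1\choose i-1}_q+q^i{n-1\choose i}_q$. Empty products equal $1$. *)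

theory Defs
  imports
    "HOL-Combinatorics.Permutations"
    "HOL-Computational_Algebra.Polynomial_Factorial"
begin

text \<open>
  All permutations are functions \<^typ>\<open>int \<Rightarrow> int\<close> that are the identity outside the set
  they permute, so that distinct elements of a group are distinct functions.
  The statistics below only look at the values on \<open>{1..d}\<close>.
\<close>

definition perms_A :: "nat \<Rightarrow> (int \<Rightarrow> int) set" where
  "perms_A d = {\<sigma>. \<sigma> permutes {1..int d}}"

definition perms_BC :: "nat \<Rightarrow> (int \<Rightarrow> int) set" where
  "perms_BC d = {\<sigma>. \<sigma> permutes ({- int d..-1} \<union> {1..int d}) \<and>
                    (\<forall>i\<in>{- int d..-1} \<union> {1..int d}. \<sigma> (- i) = - \<sigma> i)}"

definition Neg :: "nat \<Rightarrow> (int \<Rightarrow> int) \<Rightarrow> int set" where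
  "Neg d \<sigma> = {i. 1 \<le> i \<and> i \<le> int d \<and> \<sigma> i < 0}"

definition perms_D :: "nat \<Rightarrow> (int \<Rightarrow> int) set" where
  "perms_D d = {\<sigma> \<in> perms_BC d. even (card (Neg d \<sigma>))}"

definition Inv :: "nat \<Rightarrow> (int \<Rightarrow> int) \<Rightarrow> nat" where
  "Inv d \<sigma> = card {(i, j). 0 < i \<and> i < j \<and> j \<le> int d \<and> \<sigma> i * \<sigma> j * (\<sigma> i - \<sigma> j) > 0}"

definition len_A :: "nat \<Rightarrow> (int \<Rightarrow> int) \<Rightarrow> nat" where
  "len_A d \<sigma> = Inv d \<sigma>"

text \<open>
  Signed permutations satisfy \<open>\<sigma> i \<ge> - int d\<close> on \<open>{1..d}\<close>, so \<^const>\<open>nat\<close> does not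
  truncate in the next two definitions.
\<close>

definition len_BC :: "nat \<Rightarrow> (int \<Rightarrow> int) \<Rightarrow> nat" where
  "len_BC d \<sigma> = Inv d \<sigma> + (\<Sum>i\<in>Neg d \<sigma>. nat (int d + 1 + \<sigma> i))"

definition len_D :: "nat \<Rightarrow> (int \<Rightarrow> int) \<Rightarrow> nat" where
  "len_D d \<sigma> = Inv d \<sigma> + (\<Sum>i\<in>Neg d \<sigma>. nat (int d + \<sigma> i))"

definition Wmaj :: "nat \<Rightarrow> (int \<Rightarrow> int) \<Rightarrow> nat" where
  "Wmaj d \<sigma> = (\<Sum>i | 1 \<le> i \<and> i < int d \<and> \<sigma> i > \<sigma> (i + 1). nat i) + card (Neg d \<sigma>)"

definition beta :: "nat \<Rightarrow> (int \<Rightarrow> int) \<Rightarrow> nat" where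
  "beta d \<sigma> = (if \<sigma> (int d) < 0 then 1 else 0) +
     card {i. 1 \<le> i \<and> i < int d \<and> \<sigma> i * \<sigma> (i + 1) * (\<sigma> i - \<sigma> (i + 1)) > 0}"

definition M_A :: "nat \<Rightarrow> 'a \<Rightarrow> 'a \<Rightarrow> 'a \<Rightarrow> 'a::comm_ring_1" where
  "M_A d q s t = (\<Sum>\<sigma>\<in>perms_A d. q ^ len_A d \<sigma> * s ^ beta d \<sigma> * t ^ Wmaj d \<sigma>)"

definition M_BC :: "nat \<Rightarrow> 'a \<Rightarrow> 'a \<Rightarrow> 'a \<Rightarrow> 'a::comm_ring_1" where
  "M_BC d q s t = (\<Sum>\<sigma>\<in>perms_BC d. q ^ len_BC d \<sigma> * s ^ beta d \<sigma> * t ^ Wmaj d \<sigma>)"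

definition M_D :: "nat \<Rightarrow> 'a \<Rightarrow> 'a \<Rightarrow> 'a \<Rightarrow> 'a::comm_ring_1" where
  "M_D d q s t = (\<Sum>\<sigma>\<in>perms_D d. q ^ len_D d \<sigma> * s ^ beta d \<sigma> * t ^ Wmaj d \<sigma>)"

text \<open>The value \<open>0\<close> for \<open>i > n\<close> only serves to make the function total.\<close>

fun qbinom :: "'a::comm_ring_1 \<Rightarrow> nat \<Rightarrow> nat \<Rightarrow> 'a" where
  "qbinom q n i =
     (if i = 0 \<or> i = n then 1
      else if i > n then 0
      else qbinom q (n - 1) (i - 1) + q ^ i * qbinom q (n - 1) i)"

declare qbinom.simps [simp del]

text \<open>
  The field of rational functions over the integers in three indeterminates, realised as the
  fraction field of \<open>\<int>[q][s][t]\<close>.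
\<close>

type_synonym ratfun = "int poly poly poly fract"

definition var_q :: ratfun where
  "var_q = to_fract [:[:[:0, 1:]:]:]"

definition var_s :: ratfun where
  "var_s = to_fract [:[:0, 1:]:]"

definition var_t :: ratfun where
  "var_t = to_fract [:0, 1:]"

end

theory Submission
  imports Defs "HOL-Combinatorics.Multiset_Permutations"
begin

text \<open>
  In the order \<open>1 < \<dots> < d < -d < \<dots> < -1\<close>, \<^const>\<open>Inv\<close> counts inversions, and \<^const>\<open>beta\<close> and
  \<^const>\<open>Wmaj\<close> are the number and the sum of the descents, where \<open>d\<close> counts as a descent of \<open>\<sigma>\<close> if
  \<open>\<sigma> d < 0\<close>. Hence each summand is a power of \<open>q\<close> times a product over the positions \<open>i\<close> of
  \<open>x\<^sub>i = s t\<^sup>i\<close> (descent) or \<open>1 = x\<^sub>i + (1 - x\<^sub>i)\<close> (no descent). Expand, and let \<open>k\<close> be the last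
  position that contributes \<open>x\<^sub>k\<close>: the word is then increasing and positive after position \<open>k\<close>, so it
  amounts to the signed set of its first \<open>k\<close> values together with a permutation of them. The
  permutations contribute \<open>M_A k\<close>, and the generating function of the signed sets is computed
  with \<open>q\<close>-binomial identities.
\<close>

section \<open>Gaussian binomial coefficients\<close>

lemma qbinom_0 [simp]: "qbinom q n 0 = 1"
  by (simp add: qbinom.simps)

lemma qbinom_self [simp]: "qbinom q n n = 1"
  by (simp add: qbinom.simps)

lemma qbinom_eq_0 [simp]: "n < k \<Longrightarrow> qbinom q n k = 0"
  by (simp add: qbinom.simps)

lemma qbinom_Suc_Suc:
  "qbinom q (Suc n) (Suc k) = qbinom q n k + q ^ Suc k * qbinom q n (Suc k)"
proof (cases "k = n")
  case False
  then show ?thesis by (subst qbinom.simps) (auto simp: qbinom_eq_0)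
qed simp

lemma qbinom_trinomial_revision:
  "m \<le> k \<Longrightarrow> k \<le> n \<Longrightarrow> qbinom q n k * qbinom q k m = qbinom q n m * qbinom q (n - m) (k - m)"
proof (induction n arbitrary: k m)
  case (Suc n)
  show ?case
  proof (cases m)
    case (Suc m')
    then obtain k' where k: "k = Suc k'" "m' \<le> k'" "k' \<le> n"
      using Suc.prems by (cases k) auto
    have A: "qbinom q n k' * qbinom q k' m' = qbinom q n m' * qbinom q (n - m') (k' - m')"
      using Suc.IH k by simp
    have B: "qbinom q n k' * qbinom q k' (Suc m') =
        qbinom q n (Suc m') * (if Suc m' \<le> k' then qbinom q (n - Suc m') (k' - Suc m') else 0)"
      using Suc.IH[of "Suc m'" k'] k by auto
    have C: "qbinom q n (Suc k') * qbinom q (Suc k') (Suc m') =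
        qbinom q n (Suc m') * qbinom q (n - Suc m') (k' - m')"
          proof (cases "Suc k' \<le> n")
      case False
      then have "k' = n" using k by simp
      then show ?thesis using k by (cases "m' = n") auto
    qed (use Suc.IH[of "Suc m'" "Suc k'"] k in simp)
    have D: "qbinom q n (Suc m') * qbinom q (n - m') (k' - m') = qbinom q n (Suc m') *
        ((if Suc m' \<le> k' then qbinom q (n - Suc m') (k' - Suc m') else 0)
         + q ^ (k' - m') * qbinom q (n - Suc m') (k' - m'))"
    proof (cases "Suc m' \<le> k'")
      case True
      then have "n - m' = Suc (n - Suc m')" "k' - m' = Suc (k' - Suc m')" using k by auto
      then show ?thesis using True by (simp add: qbinom_Suc_Suc)
    next
      case False
      then show ?thesis using k by auto
    qed
    have "q ^ Suc k' = q ^ Suc m' * q ^ (k' - m')"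
      using k unfolding power_add[symmetric] by simp
    then have "qbinom q (Suc n) k * qbinom q k m =
        qbinom q n k' * qbinom q k' m' + q ^ Suc m' * (qbinom q n k' * qbinom q k' (Suc m'))
        + q ^ Suc m' * q ^ (k' - m') * (qbinom q n (Suc k') * qbinom q (Suc k') (Suc m'))"
      unfolding k Suc by (simp add: qbinom_Suc_Suc algebra_simps)
    also have "\<dots> = qbinom q n m' * qbinom q (n - m') (k' - m')
        + q ^ Suc m' * (qbinom q n (Suc m') * qbinom q (n - m') (k' - m'))"
      unfolding A B C D by (simp add: algebra_simps)
    finally show ?thesis
      unfolding k Suc by (simp add: qbinom_Suc_Suc algebra_simps)
  qed simp
qed simp

lemma qbinom_times_prod:
  "k \<le> n \<Longrightarrow> qbinom q n k * (\<Prod>j<k. 1 - q ^ (k - j)) = (\<Prod>j<k. 1 - q ^ (n - j))"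
proof (induction n arbitrary: k)
  case (Suc n)
  show ?case
  proof (cases k)
    case (Suc k')
    have A: "qbinom q n k' * (\<Prod>j<k'. 1 - q ^ (k' - j)) = (\<Prod>j<k'. 1 - q ^ (n - j))"
      using Suc.IH Suc.prems Suc by simp
    have B: "qbinom q n (Suc k') * (\<Prod>j<Suc k'. 1 - q ^ (Suc k' - j)) = (\<Prod>j<k'. 1 - q ^ (n - j)) * (1 - q ^ (n - k'))"
    proof (cases "Suc k' \<le> n")
      case True
      then show ?thesis using Suc.IH[of "Suc k'"] by simp
    next
      case False
      then show ?thesis using Suc.prems Suc by simp
    qed
    have C: "(\<Prod>j<Suc m. 1 - q ^ (Suc l - j)) = (1 - q ^ Suc l) * (\<Prod>j<m. 1 - q ^ (l - j))" for m l
      by (subst prod.lessThan_Suc_shift) simp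
    have E: "q ^ Suc n = q ^ Suc k' * q ^ (n - k')"
      using Suc.prems unfolding Suc power_add[symmetric] by simp
    have "qbinom q (Suc n) (Suc k') * (\<Prod>j<Suc k'. 1 - q ^ (Suc k' - j)) =
      (1 - q ^ Suc k') * (qbinom q n k' * (\<Prod>j<k'. 1 - q ^ (k' - j)))
      + q ^ Suc k' * (qbinom q n (Suc k') * (\<Prod>j<Suc k'. 1 - q ^ (Suc k' - j)))"
      unfolding qbinom_Suc_Suc distrib_right C by (simp only: mult_ac)
    also have "\<dots> = (1 - q ^ Suc n) * (\<Prod>j<k'. 1 - q ^ (n - j))"
      unfolding A B E by (simp add: algebra_simps)
    finally show ?thesis unfolding Suc C .
  qed simp
qed simp

lemma q_binomial_theorem:
  "(\<Sum>m\<le>k. qbinom q k m * q ^ (m choose 2) * z ^ m) = (\<Prod>j<k. 1 + z * q ^ j)"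
proof (induction k arbitrary: z)
  case (Suc k)
  define S where "S = (\<Sum>m\<le>k. qbinom q k m * q ^ (m choose 2) * (z * q) ^ m)"
  have S': "S = 1 + (\<Sum>m\<le>k. qbinom q k (Suc m) * q ^ (Suc m choose 2) * (z * q) ^ Suc m)"
  proof -
    have "S = (\<Sum>m\<le>Suc k. qbinom q k m * q ^ (m choose 2) * (z * q) ^ m)"
      unfolding S_def by simp
    then show ?thesis by (subst (asm) sum.atMost_Suc_shift) (simp add: numeral_2_eq_2)
  qed
  have C: "Suc m choose 2 = (m choose 2) + m" for m
    by (simp add: numeral_2_eq_2)
  have "(\<Sum>m\<le>Suc k. qbinom q (Suc k) m * q ^ (m choose 2) * z ^ m)
     = 1 + (\<Sum>m\<le>k. z * (qbinom q k m * q ^ (m choose 2) * (z * q) ^ m)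
        + qbinom q k (Suc m) * q ^ (Suc m choose 2) * (z * q) ^ Suc m)"
    by (subst sum.atMost_Suc_shift)
      (simp add: qbinom_Suc_Suc C power_add power_mult_distrib algebra_simps numeral_2_eq_2)
  also have "\<dots> = z * S + (1 + (\<Sum>m\<le>k. qbinom q k (Suc m) * q ^ (Suc m choose 2) * (z * q) ^ Suc m))"
    unfolding sum.distrib S_def sum_distrib_left by (simp only: add_ac)
  also have "\<dots> = z * S + S"
    by (simp only: S'[symmetric])
  also have "S = (\<Prod>j<k. 1 + (z * q) * q ^ j)"
    unfolding S_def by (rule Suc.IH)
  finally show ?case
    by (subst prod.lessThan_Suc_shift) (simp add: algebra_simps)
qed (simp add: numeral_2_eq_2)

section \<open>Generating functions of subsets\<close>

definition cross_inv :: "'b::linorder set \<Rightarrow> 'b set \<Rightarrow> nat" where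
  "cross_inv U V = card {(a, b). a \<in> U \<and> b \<in> V \<and> b < a}"

lemma cross_inv_altdef:
  "finite U \<Longrightarrow> finite V \<Longrightarrow> cross_inv U V = (\<Sum>a\<in>U. card {b \<in> V. b < a})"
proof -
  assume "finite U" "finite V"
  moreover have "{(a, b). a \<in> U \<and> b \<in> V \<and> b < a} = (SIGMA a:U. {b \<in> V. b < a})" by auto
  ultimately show ?thesis by (simp add: cross_inv_def)
qed

lemma sum_subsets_insert:
  assumes "finite A" "b \<notin> A"
  shows "(\<Sum>U | U \<subseteq> insert b A \<and> card U = Suc k. f U) =
    (\<Sum>U | U \<subseteq> A \<and> card U = k. f (insert b U)) + (\<Sum>U | U \<subseteq> A \<and> card U = Suc k. f U)"
proof -
  have fin: "finite {U. U \<subseteq> A \<and> P U}" for P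
    using assms(1) by (auto intro: finite_subset[of _ "Pow A"])
  have eq: "{U. U \<subseteq> insert b A \<and> card U = Suc k} =
      insert b ` {U. U \<subseteq> A \<and> card U = k} \<union> {U. U \<subseteq> A \<and> card U = Suc k}" (is "?L = ?R")
  proof (intro equalityI subsetI)
    fix U assume U: "U \<in> ?L"
    show "U \<in> ?R"
    proof (cases "b \<in> U")
      case True
      then have "U = insert b (U - {b})" "U - {b} \<subseteq> A" "card (U - {b}) = k" using U by auto
      then show ?thesis by blast
    qed (use U in auto)
  next
    fix U assume "U \<in> ?R"
    then show "U \<in> ?L"
      using assms finite_subset[OF _ assms(1)] by (auto simp: card_insert_if)
  qed
  have "inj_on (insert b) {U. U \<subseteq> A \<and> card U = k}"
    using assms(2) by (intro inj_onI) (metis insert_ident mem_Collect_eq subsetD)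
  then show ?thesis
    unfolding eq using assms(2)
    by (subst sum.union_disjoint) (auto simp: sum.reindex fin)
qed

lemma sum_cross_inv:
  fixes T :: "'b::linorder set"
  assumes "finite T"
  shows "(\<Sum>U | U \<subseteq> T \<and> card U = k. q ^ cross_inv U (T - U)) = qbinom q (card T) k"
  using assms
proof (induction T arbitrary: k rule: finite_linorder_min_induct)
  case empty
  have "{U::'b set. U = {} \<and> card U = k} = (if k = 0 then {{}} else {})" by auto
  then show ?case by (simp add: cross_inv_def)
next
  case (insert b A)
  have b: "b \<notin> A" using insert by auto
  show ?case
  proof (cases k)
    case 0
    have "{U. U \<subseteq> insert b A \<and> card U = 0} = {{}}"
      using insert.hyps(1) by (auto dest: finite_subset)
    then show ?thesis using 0 by (simp add: cross_inv_def)
  next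
    case (Suc k')
    have 1: "cross_inv (insert b U) (A - insert b U) = cross_inv U (A - U)"
      if "U \<subseteq> A" for U
    proof -
      have "A - insert b U = A - U" using b that by auto
      then show ?thesis
        unfolding cross_inv_def using that insert.hyps b
        by (intro arg_cong[where f = card]) (auto dest: less_asym)
    qed
    have 2: "cross_inv U (insert b A - U) = card U + cross_inv U (A - U)"
      if "U \<subseteq> A" for U
    proof -
      have "finite U" using that insert.hyps finite_subset by blast
      moreover have "{c \<in> insert b A - U. c < a} = insert b {c \<in> A - U. c < a}" if "a \<in> U" for a
        using that \<open>U \<subseteq> A\<close> insert.hyps b by auto
      ultimately show ?thesis
        using b insert.hyps(1) by (simp add: cross_inv_altdef sum.distrib sum_Suc)
    qed
    have "(\<Sum>U | U \<subseteq> insert b A \<and> card U = k. q ^ cross_inv U (insert b A - U)) =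
      (\<Sum>U | U \<subseteq> A \<and> card U = k'. q ^ cross_inv U (A - U))
      + (\<Sum>U | U \<subseteq> A \<and> card U = Suc k'. q ^ Suc k' * q ^ cross_inv U (A - U))"
      unfolding Suc using insert.hyps(1) b
      by (subst sum_subsets_insert)
        (auto simp: 1 2 power_add simp del: Diff_insert0 intro!: sum.cong arg_cong2[where f = "(+)"] arg_cong[where f = "power q"])
    also have "\<dots> = qbinom q (card (insert b A)) k"
      unfolding sum_distrib_left[symmetric] insert.IH using insert.hyps(1) b Suc
      by (simp add: qbinom_Suc_Suc)
    finally show ?thesis .
  qed
qed

lemma sum_subsets_codegree:
  "(\<Sum>N | N \<subseteq> {1..int d} \<and> card N = m. q ^ (\<Sum>n\<in>N. nat (int d - n))) =
    q ^ (m choose 2) * qbinom q d m"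
proof (induction d arbitrary: m)
  case 0
  have "{U::int set. U = {} \<and> card U = m} = (if m = 0 then {{}} else {})" by auto
  then show ?case by (simp add: numeral_2_eq_2)
next
  case (Suc d)
  show ?case
  proof (cases m)
    case 0
    have "{U. U \<subseteq> {1..int (Suc d)} \<and> card U = 0} = {{}}"
      by (auto dest: finite_subset[OF _ finite_atLeastAtMost_int])
    then show ?thesis using 0 by (simp add: numeral_2_eq_2)
  next
    case (Suc m')
    have I: "{1..int (Suc d)} = insert (int (Suc d)) {1..int d}" by auto
    have S: "(\<Sum>n\<in>N. nat (int (Suc d) - n)) = card N + (\<Sum>n\<in>N. nat (int d - n))"
      if "N \<subseteq> {1..int d}" for N
    proof -
      have "nat (int (Suc d) - n) = Suc (nat (int d - n))" if "n \<in> N" for n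
      proof -
        have "n \<le> int d" using that \<open>N \<subseteq> {1..int d}\<close> by auto
        then show ?thesis by linarith
      qed
      then show ?thesis by (simp add: sum_Suc)
    qed
    have S': "(\<Sum>n\<in>insert (int (Suc d)) N. nat (int (Suc d) - n)) = card N + (\<Sum>n\<in>N. nat (int d - n))"
      if "N \<subseteq> {1..int d}" for N
      using that S[OF that] finite_subset[OF that] by (subst sum.insert) auto
    have "(\<Sum>N | N \<subseteq> {1..int (Suc d)} \<and> card N = m. q ^ (\<Sum>n\<in>N. nat (int (Suc d) - n))) =
      (\<Sum>N | N \<subseteq> {1..int d} \<and> card N = m'. q ^ m' * q ^ (\<Sum>n\<in>N. nat (int d - n)))
      + (\<Sum>N | N \<subseteq> {1..int d} \<and> card N = Suc m'. q ^ Suc m' * q ^ (\<Sum>n\<in>N. nat (int d - n)))"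
      unfolding Suc I
      by (subst sum_subsets_insert)
        (auto simp: S S' power_add simp del: of_nat_Suc intro!: sum.cong arg_cong2[where f = "(+)"])
    also have "\<dots> = q ^ (m choose 2) * qbinom q (Suc d) m"
      unfolding sum_distrib_left[symmetric] Suc.IH Suc
      by (simp add: qbinom_Suc_Suc numeral_2_eq_2 power_add algebra_simps)
    finally show ?thesis .
  qed
qed

section \<open>Words weighted by inversions and descents\<close>

fun word_inv :: "'b::linorder list \<Rightarrow> nat" where
  "word_inv [] = 0"
| "word_inv (a # u) = card {b \<in> set u. b < a} + word_inv u"

text \<open>Position \<open>i\<close> compares the \<open>i\<close>-th and the \<open>(i + 1)\<close>-st letter, counted from 1.\<close>

definition des_weight :: "(nat \<Rightarrow> 'a::comm_ring_1) \<Rightarrow> 'b::linorder list \<Rightarrow> 'a" where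
  "des_weight x u = (\<Prod>i=1..<length u. if u ! i < u ! (i - 1) then x i else 1)"

definition word_sum :: "'a::comm_ring_1 \<Rightarrow> (nat \<Rightarrow> 'a) \<Rightarrow> 'b::linorder set \<Rightarrow> 'a" where
  "word_sum q x T = (\<Sum>u\<in>permutations_of_set T. q ^ word_inv u * des_weight x u)"

lemma word_inv_append:
  assumes "distinct (u @ v)"
  shows "word_inv (u @ v) = word_inv u + word_inv v + cross_inv (set u) (set v)"
  using assms
proof (induction u)
  case (Cons a u)
  have "{b \<in> set (u @ v). b < a} = {b \<in> set u. b < a} \<union> {b \<in> set v. b < a}" by auto
  then have "card {b \<in> set (u @ v). b < a} = card {b \<in> set u. b < a} + card {b \<in> set v. b < a}"
    using Cons.prems by (simp only:) (intro card_Un_disjoint, auto)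
  then show ?case using Cons by (simp add: cross_inv_altdef)
qed (simp add: cross_inv_def)

lemma word_inv_sorted: "sorted u \<Longrightarrow> word_inv u = 0"
  by (induction u) (auto simp: not_less)

lemma word_inv_map:
  assumes "strict_mono_on (set u) f" "distinct u"
  shows "word_inv (map f u) = word_inv u"
  using assms
proof (induction u)
  case (Cons a u)
  have *: "f b < f a \<longleftrightarrow> b < a" if "b \<in> set u" for b
    using that Cons.prems(1) by (intro strict_mono_on_less[of "set (a # u)"]) auto
  have "inj_on f (set u)"
    using Cons.prems(1) by (meson inj_on_subset set_subset_Cons strict_mono_on_imp_inj_on)
  then have "inj_on f {b \<in> set u. b < a}"
    by (rule inj_on_subset) auto
  moreover have "{b \<in> f ` set u. b < f a} = f ` {b \<in> set u. b < a}"
    using * by auto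
  ultimately have "card {b \<in> f ` set u. b < f a} = card {b \<in> set u. b < a}"
    by (simp add: card_image)
  moreover have "strict_mono_on (set u) f"
    using Cons.prems(1) by (rule monotone_on_subset) auto
  ultimately show ?case using Cons by simp
qed simp

lemma des_weight_map:
  assumes "strict_mono_on (set u) f"
  shows "des_weight x (map f u) = des_weight x u"
proof -
  have "f (u ! i) < f (u ! (i - 1)) \<longleftrightarrow> u ! i < u ! (i - 1)" if "i \<in> {1..<length u}" for i
    using that assms by (intro strict_mono_on_less[of "set u"]) auto
  moreover have "map f u ! (i - 1) = f (u ! (i - 1))" if "i \<in> {1..<length u}" for i
    using that by auto
  ultimately show ?thesis unfolding des_weight_def by (intro prod.cong) auto
qed

lemma word_sum_cong_card:
  fixes U :: "int set"
  assumes "finite U" "card U = k"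
  shows "word_sum q x U = word_sum q x {1..int k}"
proof -
  define f where "f i = sorted_list_of_set U ! nat (i - 1)" for i
  have mono: "strict_mono_on {1..int k} f"
  proof (rule strict_mono_onI)
    fix i j assume "i \<in> {1..int k}" "j \<in> {1..int k}" "i < j"
    then show "f i < f j"
      unfolding f_def using assms
      by (intro sorted_wrt_nth_less[OF strict_sorted_list_of_set]) auto
  qed
  then have inj: "inj_on f {1..int k}" by (rule strict_mono_on_imp_inj_on)
  have "f ` {1..int k} \<subseteq> U"
  proof
    fix y assume "y \<in> f ` {1..int k}"
    then obtain i where "i \<in> {1..int k}" "y = f i" by auto
    then have "y \<in> set (sorted_list_of_set U)"
      unfolding f_def using assms by (auto intro!: nth_mem simp del: set_sorted_list_of_set)
    then show "y \<in> U" using assms by simp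
  qed
  moreover have "card (f ` {1..int k}) = k" using inj by (simp add: card_image)
  ultimately have img: "f ` {1..int k} = U"
    using assms by (intro card_subset_eq) auto
  have "word_sum q x U = (\<Sum>u\<in>map f ` permutations_of_set {1..int k}. q ^ word_inv u * des_weight x u)"
    unfolding word_sum_def img[symmetric] permutations_of_set_image_inj[OF inj] ..
  also have "\<dots> = (\<Sum>u\<in>permutations_of_set {1..int k}. q ^ word_inv (map f u) * des_weight x (map f u))"
  proof (subst sum.reindex)
    show "inj_on (map f) (permutations_of_set {1..int k})"
    proof (rule inj_onI)
      fix u v assume "u \<in> permutations_of_set {1..int k}" "v \<in> permutations_of_set {1..int k}"
        and eq: "map f u = map f v"
      then have "set u \<union> set v = {1..int k}" by (simp add: permutations_of_setD(1))
      then show "u = v" using eq inj by (simp add: map_inj_on)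
    qed
  qed simp
  also have "\<dots> = word_sum q x {1..int k}"
    unfolding word_sum_def
  proof (intro sum.cong refl)
    fix u assume "u \<in> permutations_of_set {1..int k}"
    then have "set u = {1..int k}" "distinct u" by (auto dest: permutations_of_setD)
    then show "q ^ word_inv (map f u) * des_weight x (map f u) = q ^ word_inv u * des_weight x u"
      using mono by (simp add: word_inv_map des_weight_map)
  qed
  finally show ?thesis .
qed

text \<open>A factor \<open>w\<close> that is \<open>x\<close> at a descent and \<open>1\<close> elsewhere equals \<open>x + (1 - x) * [no descent]\<close>;
  the summand \<open>k\<close> collects the terms in which \<open>k\<close> is the last position contributing its \<open>x\<close>.\<close>

lemma prod_if_expand:
  fixes x :: "nat \<Rightarrow> 'a::comm_ring_1"
  shows "(\<Prod>i=1..n. if P i then x i else 1) =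
    (if \<forall>i\<in>{1..n}. \<not> P i then \<Prod>i=1..n. 1 - x i else 0) +
    (\<Sum>k=1..n. x k * (if \<forall>i\<in>{k+1..n}. \<not> P i then \<Prod>i=k+1..n. 1 - x i else 0) *
       (\<Prod>i=1..<k. if P i then x i else 1))"
proof (induction n)
  case (Suc n)
  define w where "w = (\<Prod>i=1..n. if P i then x i else 1)"
  define c where "c = (if P (Suc n) then 0 else 1 - x (Suc n))"
  have step: "(if \<forall>i\<in>{k+1..Suc n}. \<not> P i then \<Prod>i=k+1..Suc n. 1 - x i else 0) =
      c * (if \<forall>i\<in>{k+1..n}. \<not> P i then \<Prod>i=k+1..n. 1 - x i else 0)" if "k \<le> n" for k
  proof -
    have "{k+1..Suc n} = insert (Suc n) {k+1..n}" using that by auto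
    then show ?thesis by (simp add: c_def)
  qed
  have "(\<Prod>i=1..Suc n. if P i then x i else 1) = x (Suc n) * w + c * w"
    by (simp add: w_def c_def algebra_simps)
  also have "c * w = c * (if \<forall>i\<in>{1..n}. \<not> P i then \<Prod>i=1..n. 1 - x i else 0) +
      (\<Sum>k=1..n. x k * (c * (if \<forall>i\<in>{k+1..n}. \<not> P i then \<Prod>i=k+1..n. 1 - x i else 0)) *
       (\<Prod>i=1..<k. if P i then x i else 1))"
    unfolding w_def Suc.IH distrib_left sum_distrib_left by (simp only: mult_ac)
  also have "\<dots> = (if \<forall>i\<in>{1..Suc n}. \<not> P i then \<Prod>i=1..Suc n. 1 - x i else 0) +
      (\<Sum>k=1..n. x k * (if \<forall>i\<in>{k+1..Suc n}. \<not> P i then \<Prod>i=k+1..Suc n. 1 - x i else 0) *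
       (\<Prod>i=1..<k. if P i then x i else 1))"
    using step[of 0] by (intro arg_cong2[where f = "(+)"] sum.cong) (simp_all only: step atLeastAtMost_iff add_0)
  finally show ?case
    by (simp add: w_def atLeastLessThanSuc_atLeastAtMost algebra_simps del: prod.cl_ivl_Suc)
qed simp

lemma sorted_drop_iff:
  fixes v :: "'b::linorder list"
  shows "sorted (drop k v) \<longleftrightarrow> (\<forall>i\<in>{k+1..<length v}. \<not> v ! i < v ! (i - 1))"
proof
  assume "sorted (drop k v)"
  then have *: "drop k v ! i \<le> drop k v ! Suc i" if "Suc i < length v - k" for i
    using that by (simp add: sorted_iff_nth_Suc)
  show "\<forall>i\<in>{k+1..<length v}. \<not> v ! i < v ! (i - 1)"
  proof
    fix i assume "i \<in> {k+1..<length v}"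
    then show "\<not> v ! i < v ! (i - 1)" using *[of "i - 1 - k"] by (auto simp: not_less)
  qed
next
  assume *: "\<forall>i\<in>{k+1..<length v}. \<not> v ! i < v ! (i - 1)"
  have "drop k v ! i \<le> drop k v ! Suc i" if "Suc i < length v - k" for i
    using *[rule_format, of "k + Suc i"] that by (auto simp: not_less)
  then show "sorted (drop k v)" by (simp add: sorted_iff_nth_Suc)
qed

lemma des_weight_expand:
  fixes v :: "'b::linorder list"
  assumes "length v = Suc n"
  shows "des_weight x v = (if sorted v then \<Prod>i=1..n. 1 - x i else 0) +
    (\<Sum>k=1..n. x k * (\<Prod>i=k+1..n. 1 - x i) *
       (if sorted (drop k v) then des_weight x (take k v) else 0))"
proof -
  have I: "{m..<length v} = {m..n}" for m using assms by auto
  have take: "(\<Prod>i=1..<k. if v ! i < v ! (i - 1) then x i else 1) = des_weight x (take k v)"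
    if "k \<le> n" for k
    unfolding des_weight_def using that assms by (intro prod.cong) auto
  have "des_weight x v = (if sorted v then \<Prod>i=1..n. 1 - x i else 0) +
    (\<Sum>k=1..n. x k * (if sorted (drop k v) then \<Prod>i=k+1..n. 1 - x i else 0) *
       (\<Prod>i=1..<k. if v ! i < v ! (i - 1) then x i else 1))"
    unfolding des_weight_def I prod_if_expand[of _ x n]
    using sorted_drop_iff[of 0 v] sorted_drop_iff[of _ v] by (simp add: I)
  also have "\<dots> = (if sorted v then \<Prod>i=1..n. 1 - x i else 0) +
    (\<Sum>k=1..n. x k * (\<Prod>i=k+1..n. 1 - x i) *
       (if sorted (drop k v) then des_weight x (take k v) else 0))"
    by (intro arg_cong2[where f = "(+)"] sum.cong) (use take in auto)
  finally show ?thesis .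
qed

text \<open>A word with sorted tail is a word on the set \<open>U\<close> of its first \<open>k\<close> letters, followed by the
  increasing enumeration of the remaining letters.\<close>

lemma sum_words_sorted_tail:
  fixes T :: "int set"
  assumes "finite T" "k \<le> card T"
  shows "(\<Sum>u\<in>permutations_of_set T. q ^ word_inv u *
      (if sorted (drop k u) \<and> Q (set (drop k u)) then des_weight x (take k u) else 0)) =
    (\<Sum>U | U \<subseteq> T \<and> card U = k \<and> Q (T - U). q ^ cross_inv U (T - U)) * word_sum q x {1..int k}"
proof -
  let ?S = "{u \<in> permutations_of_set T. sorted (drop k u) \<and> Q (set (drop k u))}"
  let ?I = "{U. U \<subseteq> T \<and> card U = k \<and> Q (T - U)}"
  let ?f = "\<lambda>(U, a). a @ sorted_list_of_set (T - U)"
  have finI: "finite ?I"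
    using assms(1) by (auto intro: finite_subset[of _ "Pow T"])
  have finU: "finite U" if "U \<subseteq> T" for U using that assms(1) by (rule finite_subset)
  have bij: "bij_betw ?f (SIGMA U:?I. permutations_of_set U) ?S"
  proof (rule bij_betw_byWitness[where f' = "\<lambda>u. (set (take k u), take k u)"])
    show "\<forall>p\<in>SIGMA U:?I. permutations_of_set U. (set (take k (?f p)), take k (?f p)) = p"
      by (auto simp: length_finite_permutations_of_set dest: permutations_of_setD)
    have compl: "set u - set (take k u) = set (drop k u)" if "distinct u" for u :: "int list"
    proof -
      have "set u = set (take k u) \<union> set (drop k u)"
        by (metis append_take_drop_id set_append)
      then show ?thesis
        using set_take_disj_set_drop_if_distinct[OF that, of k k] by auto
    qed
    show "\<forall>u\<in>?S. ?f (set (take k u), take k u) = u"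
    proof
      fix u assume u: "u \<in> ?S"
      then have "set u = T" "distinct u" by (auto dest: permutations_of_setD)
      then have "sorted_list_of_set (T - set (take k u)) = drop k u"
        using compl[of u] u by (auto intro!: sorted_distinct_set_unique)
      then show "?f (set (take k u), take k u) = u" by simp
    qed
    show "?f ` (SIGMA U:?I. permutations_of_set U) \<subseteq> ?S"
    proof (rule image_subsetI)
      fix p assume "p \<in> (SIGMA U:?I. permutations_of_set U)"
      then obtain U a where p: "p = (U, a)" and U: "U \<subseteq> T" "card U = k" "Q (T - U)"
        and a: "a \<in> permutations_of_set U" by auto
      have a': "set a = U" "distinct a" "length a = card U"
        using a by (auto dest: permutations_of_setD length_finite_permutations_of_set)
      show "?f p \<in> ?S"
        unfolding p using a' U assms(1) by (auto intro!: permutations_of_setI)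
    qed
    show "(\<lambda>u. (set (take k u), take k u)) ` ?S \<subseteq> (SIGMA U:?I. permutations_of_set U)"
    proof (rule image_subsetI)
      fix u assume "u \<in> ?S"
      then have u: "u \<in> permutations_of_set T" "Q (set (drop k u))" by auto
      have u': "set u = T" "distinct u" "length u = card T"
        using u by (auto dest: permutations_of_setD length_finite_permutations_of_set)
      show "(set (take k u), take k u) \<in> (SIGMA U:?I. permutations_of_set U)"
      proof -
        have "card (set (take k u)) = k"
          using u' assms(2) by (simp add: distinct_card)
        moreover have "set (take k u) \<subseteq> T" "T - set (take k u) = set (drop k u)"
          using u' compl[of u] set_take_subset[of k u] by simp_all
        ultimately show ?thesis using u u' by (simp add: permutations_of_setI)
      qed
    qed
  qed
  have "(\<Sum>u\<in>permutations_of_set T. q ^ word_inv u *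
      (if sorted (drop k u) \<and> Q (set (drop k u)) then des_weight x (take k u) else 0)) =
    (\<Sum>u\<in>?S. q ^ word_inv u * des_weight x (take k u))"
    by (intro sum.mono_neutral_cong_right) auto
  also have "\<dots> = (\<Sum>p\<in>(SIGMA U:?I. permutations_of_set U). q ^ word_inv (?f p) * des_weight x (take k (?f p)))"
    by (rule sum.reindex_bij_betw[OF bij, symmetric])
  also have "\<dots> = (\<Sum>U\<in>?I. \<Sum>a\<in>permutations_of_set U. q ^ word_inv (?f (U, a)) * des_weight x (take k (?f (U, a))))"
    by (subst sum.Sigma) (auto simp: finI split_def)
  also have "\<dots> = (\<Sum>U\<in>?I. q ^ cross_inv U (T - U) * word_sum q x {1..int k})"
  proof (intro sum.cong refl)
    fix U assume U: "U \<in> ?I"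
    have "q ^ word_inv (?f (U, a)) * des_weight x (take k (?f (U, a))) =
      q ^ cross_inv U (T - U) * (q ^ word_inv a * des_weight x a)" if "a \<in> permutations_of_set U" for a
    proof -
      have a': "set a = U" "distinct a" "length a = k"
        using that U by (auto dest: permutations_of_setD length_finite_permutations_of_set)
      moreover have "word_inv (a @ sorted_list_of_set (T - U)) = word_inv a + cross_inv U (T - U)"
        using a' assms(1) by (subst word_inv_append) (auto simp: word_inv_sorted)
      ultimately show ?thesis by (simp add: power_add mult_ac)
    qed
    then have "(\<Sum>a\<in>permutations_of_set U. q ^ word_inv (?f (U, a)) * des_weight x (take k (?f (U, a)))) =
      q ^ cross_inv U (T - U) * word_sum q x U"
      unfolding word_sum_def sum_distrib_left by (intro sum.cong) auto
    then show "(\<Sum>a\<in>permutations_of_set U. q ^ word_inv (?f (U, a)) * des_weight x (take k (?f (U, a)))) =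
      q ^ cross_inv U (T - U) * word_sum q x {1..int k}"
      using word_sum_cong_card[of U k q x] U finU by simp
  qed
  finally show ?thesis by (simp add: sum_distrib_right)
qed

lemma word_sum_0 [simp]: "word_sum q x {} = 1"
  by (simp add: word_sum_def des_weight_def)

lemma word_sum_rec:
  fixes T :: "int set"
  assumes "finite T" "card T = Suc n"
  shows "word_sum q x T = (\<Prod>i=1..n. 1 - x i) +
    (\<Sum>k=1..n. x k * (\<Prod>i=k+1..n. 1 - x i) * (qbinom q (Suc n) k * word_sum q x {1..int k}))"
proof -
  have len: "length u = Suc n" if "u \<in> permutations_of_set T" for u
    using that assms by (simp add: length_finite_permutations_of_set)
  have tail: "(\<Sum>u\<in>permutations_of_set T. q ^ word_inv u *
      (if sorted (drop k u) then des_weight x (take k u) else 0)) =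
    qbinom q (Suc n) k * word_sum q x {1..int k}" if "k \<le> n" for k
    using sum_words_sorted_tail[of T k q "\<lambda>_. True" x] sum_cross_inv[of T q k] assms that by simp
  have "word_sum q x T = (\<Sum>u\<in>permutations_of_set T.
      (\<Prod>i=1..n. 1 - x i) * (q ^ word_inv u * (if sorted (drop 0 u) then des_weight x (take 0 u) else 0)) +
      (\<Sum>k=1..n. x k * (\<Prod>i=k+1..n. 1 - x i) *
        (q ^ word_inv u * (if sorted (drop k u) then des_weight x (take k u) else 0))))"
    unfolding word_sum_def
    by (intro sum.cong refl, subst des_weight_expand[OF len], assumption)
      (simp add: des_weight_def[of x "[]"] sum_distrib_left algebra_simps)
  also have "\<dots> = (\<Prod>i=1..n. 1 - x i) + (\<Sum>k=1..n. x k * (\<Prod>i=k+1..n. 1 - x i) *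
      (qbinom q (Suc n) k * word_sum q x {1..int k}))"
    unfolding sum.distrib sum.swap[of _ "{1..n}"] sum_distrib_left[symmetric]
    using tail[of 0]
    by (intro arg_cong2[where f = "(+)"] sum.cong) (simp_all add: tail del: drop_0 take_0)
  finally show ?thesis .
qed

text \<open>Appending \<open>c\<close> makes the last position a descent exactly if the last letter exceeds \<open>c\<close>.\<close>

lemma word_sum_threshold_rec:
  fixes T :: "int set"
  assumes "finite T"
  shows "(\<Sum>u\<in>permutations_of_set T. q ^ word_inv u * des_weight x (u @ [c])) =
    (if \<forall>v\<in>T. v \<le> c then \<Prod>i=1..card T. 1 - x i else 0) +
    (\<Sum>k=1..card T. x k * (\<Prod>i=k+1..card T. 1 - x i) *
      ((\<Sum>U | U \<subseteq> T \<and> card U = k \<and> (\<forall>v\<in>T - U. v \<le> c). q ^ cross_inv U (T - U)) *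
        word_sum q x {1..int k}))"
proof -
  let ?n = "card T"
  let ?H = "\<lambda>k. (\<Sum>U | U \<subseteq> T \<and> card U = k \<and> (\<forall>v\<in>T - U. v \<le> c). q ^ cross_inv U (T - U))"
  let ?g = "\<lambda>k u. if sorted (drop k u) \<and> (\<forall>v\<in>set (drop k u). v \<le> c) then des_weight x (take k u) else 0"
  have len: "length u = ?n" if "u \<in> permutations_of_set T" for u
    using that assms by (simp add: length_finite_permutations_of_set)
  have tail: "(\<Sum>u\<in>permutations_of_set T. q ^ word_inv u * ?g k u) = ?H k * word_sum q x {1..int k}"
    if "k \<le> ?n" for k
    using sum_words_sorted_tail[of T k q "\<lambda>V. \<forall>v\<in>V. v \<le> c" x] assms that by simp
  have "{U. U \<subseteq> T \<and> card U = 0 \<and> (\<forall>v\<in>T - U. v \<le> c)} = (if \<forall>v\<in>T. v \<le> c then {{}} else {})"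
    using finite_subset[OF _ assms] by (auto simp: card_eq_0_iff)
  then have H0: "?H 0 = (if \<forall>v\<in>T. v \<le> c then 1 else 0)"
    by (simp add: cross_inv_def)
  have "(\<Sum>u\<in>permutations_of_set T. q ^ word_inv u * des_weight x (u @ [c])) =
    (\<Sum>u\<in>permutations_of_set T.
      (\<Prod>i=1..?n. 1 - x i) * (q ^ word_inv u * ?g 0 u) +
      (\<Sum>k=1..?n. x k * (\<Prod>i=k+1..?n. 1 - x i) * (q ^ word_inv u * ?g k u)))"
  proof (intro sum.cong refl)
    fix u assume u: "u \<in> permutations_of_set T"
    have "des_weight x (u @ [c]) = (\<Prod>i=1..?n. 1 - x i) * ?g 0 u +
        (\<Sum>k=1..?n. x k * (\<Prod>i=k+1..?n. 1 - x i) * ?g k u)"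
      using len[OF u]
      by (subst des_weight_expand[of _ ?n])
        (auto simp: sorted_append des_weight_def[of x "[]"] intro!: arg_cong2[where f = "(+)"] sum.cong)
    then show "q ^ word_inv u * des_weight x (u @ [c]) =
      (\<Prod>i=1..?n. 1 - x i) * (q ^ word_inv u * ?g 0 u) +
      (\<Sum>k=1..?n. x k * (\<Prod>i=k+1..?n. 1 - x i) * (q ^ word_inv u * ?g k u))"
      by (simp only: distrib_left sum_distrib_left mult_ac)
  qed
  also have "\<dots> = (\<Prod>i=1..?n. 1 - x i) * ?H 0 + (\<Sum>k=1..?n. x k * (\<Prod>i=k+1..?n. 1 - x i) *
      (?H k * word_sum q x {1..int k}))"
    unfolding sum.distrib sum.swap[of _ "{1..?n}"] sum_distrib_left[symmetric]
    using tail[of 0] by (intro arg_cong2[where f = "(+)"] sum.cong) (simp_all add: tail del: drop_0 take_0)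
  also have "(\<Prod>i=1..?n. 1 - x i) * ?H 0 = (if \<forall>v\<in>T. v \<le> c then \<Prod>i=1..?n. 1 - x i else 0)"
    by (simp add: H0)
  finally show ?thesis .
qed

lemma sum_cross_inv_threshold:
  fixes L B :: "int set"
  assumes "finite L" "finite B" "\<forall>v\<in>L. v \<le> c" "\<forall>v\<in>B. c < v"
  shows "(\<Sum>U | U \<subseteq> L \<union> B \<and> card U = k \<and> (\<forall>v\<in>(L \<union> B) - U. v \<le> c). q ^ cross_inv U (L \<union> B - U)) =
    (if card B \<le> k then q ^ (card B * (card L + card B - k)) * qbinom q (card L) (k - card B) else 0)"
proof -
  have disj: "L \<inter> B = {}" using assms by force
  have fin: "finite P" if "P \<subseteq> L" for P using that assms(1) by (rule finite_subset)
  have cardU: "card (P \<union> B) = card P + card B" if "P \<subseteq> L" for P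
    using that disj assms fin by (intro card_Un_disjoint) auto
  let ?P = "{P. P \<subseteq> L \<and> card P + card B = k}"
  have eq: "{U. U \<subseteq> L \<union> B \<and> card U = k \<and> (\<forall>v\<in>(L \<union> B) - U. v \<le> c)} = (\<lambda>P. P \<union> B) ` ?P" (is "?A = _")
  proof (intro equalityI subsetI)
    fix U assume U: "U \<in> ?A"
    then have "B \<subseteq> U" using assms(4) by force
    then have "U = (U \<inter> L) \<union> B" using U by auto
    moreover have "U \<inter> L \<in> ?P" using U cardU[of "U \<inter> L"] calculation by auto
    ultimately show "U \<in> (\<lambda>P. P \<union> B) ` ?P" by blast
  qed (use assms cardU in auto)
  have inj: "inj_on (\<lambda>P. P \<union> B) ?P" using disj by (intro inj_onI) auto
  have cross: "cross_inv (P \<union> B) (L \<union> B - (P \<union> B)) = card B * (card L - card P) + cross_inv P (L - P)"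
    if "P \<subseteq> L" for P
  proof -
    have "L \<union> B - (P \<union> B) = L - P" using disj that by auto
    moreover have "{b \<in> L - P. b < a} = L - P" if "a \<in> B" for a
      using that assms by force
    moreover have "card (L - P) = card L - card P"
      using that fin by (simp add: card_Diff_subset)
    ultimately show ?thesis
      using assms fin[OF that] disj that
      by (simp add: cross_inv_altdef, subst sum.union_disjoint) auto
  qed
  have "(\<Sum>U | U \<subseteq> L \<union> B \<and> card U = k \<and> (\<forall>v\<in>(L \<union> B) - U. v \<le> c). q ^ cross_inv U (L \<union> B - U)) =
    (\<Sum>P\<in>?P. q ^ (card B * (card L + card B - k)) * q ^ cross_inv P (L - P))"
    unfolding eq sum.reindex[OF inj]
    by (intro sum.cong refl) (auto simp: cross power_add)
  also have "\<dots> = (if card B \<le> k then q ^ (card B * (card L + card B - k)) * qbinom q (card L) (k - card B) else 0)"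
  proof (cases "card B \<le> k")
    case True
    then have "?P = {P. P \<subseteq> L \<and> card P = k - card B}" by auto
    then show ?thesis using True sum_cross_inv[OF assms(1), of q "k - card B"]
      by (simp flip: sum_distrib_left)
  next
    case False
    then have "?P = {}" by auto
    then show ?thesis using False by simp
  qed
  finally show ?thesis .
qed

lemma word_inv_eq_card:
  fixes h :: "int \<Rightarrow> int"
  assumes "inj_on h {1..int n}"
  shows "card {(i, j). 0 < i \<and> i < j \<and> j \<le> int n \<and> h j < h i} = word_inv (map h [1..int n])"
  using assms
proof (induction n)
  case 0
  have "{(i, j). 0 < i \<and> i < j \<and> j \<le> int 0 \<and> h j < h i} = {}" by auto
  then show ?case by (simp only: card.empty) simp
next
  case (Suc n)
  let ?m = "int (Suc n)"
  let ?A = "{(i, j). 0 < i \<and> i < j \<and> j \<le> int n \<and> h j < h i}"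
  let ?B = "(\<lambda>i. (i, ?m)) ` {i \<in> {1..int n}. h ?m < h i}"
  have inj: "inj_on h {1..int n}"
    using Suc.prems by (rule inj_on_subset) auto
  have upto: "[1..?m] = [1..int n] @ [?m]"
    using upto_rec2[of 1 ?m] by simp
  have dist: "distinct (map h [1..int n] @ [h ?m])"
    using Suc.prems upto by (metis distinct_map distinct_upto list.map map_append set_upto)
  have "{(x, b). x \<in> h ` {1..int n} \<and> b \<in> {h ?m} \<and> b < x} =
      (\<lambda>i. (h i, h ?m)) ` {i \<in> {1..int n}. h ?m < h i}" by auto
  moreover have "inj_on (\<lambda>i. (h i, h ?m)) {i \<in> {1..int n}. h ?m < h i}"
    using inj by (auto simp: inj_on_def)
  ultimately have "cross_inv (set (map h [1..int n])) (set [h ?m]) = card {i \<in> {1..int n}. h ?m < h i}"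
    by (simp add: cross_inv_def card_image)
  also have "\<dots> = card ?B" by (subst card_image) (auto simp: inj_on_def)
  finally have "word_inv (map h [1..?m]) = word_inv (map h [1..int n]) + card ?B"
    unfolding upto using dist by (simp add: word_inv_append)
  moreover have "{(i, j). 0 < i \<and> i < j \<and> j \<le> ?m \<and> h j < h i} = ?A \<union> ?B" (is "?L = _")
  proof (intro equalityI subsetI)
    fix p assume p: "p \<in> ?L"
    then obtain i j where ij: "p = (i, j)" by (cases p)
    show "p \<in> ?A \<union> ?B"
      using p by (cases "j = ?m") (auto simp: ij)
  qed auto
  moreover have "card (?A \<union> ?B) = card ?A + card ?B"
  proof (rule card_Un_disjoint)
    show "finite ?A"
      by (rule finite_subset[of _ "{0..int n} \<times> {0..int n}"]) auto
    have "{i \<in> {1..int n}. h ?m < h i} \<subseteq> {1..int n}" by auto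
    then show "finite ?B" by (intro finite_imageI) (rule finite_subset, auto)
  qed auto
  ultimately show ?case using Suc.IH[OF inj] by simp
qed

lemma des_weight_snoc:
  assumes "u \<noteq> []"
  shows "des_weight x (u @ [c]) = des_weight x u * (if c < last u then x (length u) else 1)"
proof -
  have "{1..<length (u @ [c])} = insert (length u) {1..<length u}"
    using assms by (auto simp: Suc_le_eq)
  moreover have "(\<Prod>i=1..<length u. if (u @ [c]) ! i < (u @ [c]) ! (i - 1) then x i else 1) = des_weight x u"
    unfolding des_weight_def by (intro prod.cong) (auto simp: nth_append)
  ultimately show ?thesis
    unfolding des_weight_def[of x "u @ [c]"] using assms
    by (simp add: nth_append last_conv_nth mult.commute)
qed

section \<open>Permutations and signed permutations as words\<close>

text \<open>The comparison used by \<^const>\<open>Inv\<close> and \<^const>\<open>beta\<close> is the one of the order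
  \<open>1 < \<dots> < d < -d < \<dots> < -1\<close>, which \<open>sign_rank d\<close> maps to the usual order of \<open>{1..2d}\<close>.\<close>

definition sign_rank :: "nat \<Rightarrow> int \<Rightarrow> int" where
  "sign_rank d v = (if 0 < v then v else 2 * int d + 1 + v)"

lemma sign_rank_less_iff:
  assumes "a \<noteq> 0" "b \<noteq> 0" "\<bar>a\<bar> \<le> int d" "\<bar>b\<bar> \<le> int d"
  shows "sign_rank d b < sign_rank d a \<longleftrightarrow> a * b * (a - b) > 0"
  using assms by (auto simp: sign_rank_def zero_less_mult_iff mult_less_0_iff)

lemma inj_on_sign_rank: "inj_on (sign_rank d) {- int d..int d}"
  by (auto simp: inj_on_def sign_rank_def split: if_splits)

lemma beta_altdef:
  "beta d f = (\<Sum>i=1..<d. if f (int i) * f (int i + 1) * (f (int i) - f (int i + 1)) > 0 then 1 else 0)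
    + (if f (int d) < 0 then 1 else 0)"
proof -
  let ?P = "\<lambda>i. f i * f (i + 1) * (f i - f (i + 1)) > 0"
  have "{i. 1 \<le> i \<and> i < int d \<and> ?P i} = int ` {i \<in> {1..<d}. ?P (int i)}" (is "?L = ?R")
  proof (intro equalityI subsetI)
    fix i assume "i \<in> ?L"
    then have "i = int (nat i)" "nat i \<in> {i \<in> {1..<d}. ?P (int i)}" by auto
    then show "i \<in> ?R" by blast
  qed auto
  then have "card ?L = card {i \<in> {1..<d}. ?P (int i)}" by (simp add: card_image)
  also have "\<dots> = (\<Sum>i=1..<d. if ?P (int i) then 1 else 0)"
    by (simp add: sum.If_cases Int_def)
  finally show ?thesis by (simp add: beta_def)
qed

lemma Wmaj_Suc:
  assumes "1 \<le> d"
  shows "Wmaj (Suc d) f = Wmaj d f + (if f (int d) > f (int d + 1) then d else 0) + (if f (int d + 1) < 0 then 1 else 0)"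
proof -
  let ?D = "\<lambda>n. {i. 1 \<le> i \<and> i < int n \<and> f i > f (i + 1)}"
  have "?D (Suc d) = (if f (int d) > f (int d + 1) then insert (int d) (?D d) else ?D d)"
    using assms by (auto simp: order_less_le)
  moreover have "finite (?D d)" by (rule finite_subset[of _ "{1..int d}"]) auto
  ultimately have 1: "(\<Sum>i\<in>?D (Suc d). nat i) = (\<Sum>i\<in>?D d. nat i) + (if f (int d) > f (int d + 1) then d else 0)"
    by simp
  have "Neg (Suc d) f = (if f (int d + 1) < 0 then insert (int d + 1) (Neg d f) else Neg d f)"
    by (auto simp: Neg_def order_le_less add.commute)
  moreover have "finite (Neg d f)" "int d + 1 \<notin> Neg d f"
    by (auto simp: Neg_def intro: finite_subset[of _ "{1..int d}"])
  ultimately have "card (Neg (Suc d) f) = card (Neg d f) + (if f (int d + 1) < 0 then 1 else 0)"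
    by simp
  with 1 show ?thesis by (simp add: Wmaj_def)
qed

text \<open>Each maximal run of negative values at the positions \<open>a + 1, \<dots>, b\<close> turns the usual descent
  \<open>a\<close> into the descent \<open>b\<close> of the order of \<^const>\<open>sign_rank\<close>; this is compensated by the
  \<open>b - a\<close> negative values that \<^const>\<open>Wmaj\<close> counts.\<close>

lemma Wmaj_altdef:
  assumes "1 \<le> d" "\<And>i. i \<in> {1..int d} \<Longrightarrow> f i \<noteq> 0"
  shows "Wmaj d f =
    (\<Sum>i=1..<d. if f (int i) * f (int i + 1) * (f (int i) - f (int i + 1)) > 0 then i else 0)
    + (if f (int d) < 0 then d else 0)"
  using assms
proof (induction d rule: nat_induct_at_least)
  case base
  have "{i. 1 \<le> i \<and> i < int 1 \<and> f i > f (i + 1)} = {}" by auto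
  moreover have "Neg 1 f = (if f 1 < 0 then {1} else {})"
  proof -
    have "1 \<le> i \<and> i \<le> int 1 \<longleftrightarrow> i = 1" for i by auto
    then show ?thesis unfolding Neg_def conj_assoc[symmetric] by auto
  qed
  ultimately show ?case unfolding Wmaj_def by (simp only:) simp
next
  case (Suc d)
  let ?P = "\<lambda>i. f (int i) * f (int i + 1) * (f (int i) - f (int i + 1)) > 0"
  have nz: "f (int d) \<noteq> 0" "f (int d + 1) \<noteq> 0"
    using Suc.hyps Suc.prems[of "int d"] Suc.prems[of "int d + 1"] by auto
  have "Wmaj d f = (\<Sum>i=1..<d. if ?P i then i else 0) + (if f (int d) < 0 then d else 0)"
    using Suc.prems by (intro Suc.IH) auto
  moreover have "(\<Sum>i=1..<Suc d. if ?P i then i else 0) =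
      (\<Sum>i=1..<d. if ?P i then i else 0) + (if ?P d then d else 0)"
    using Suc.hyps by simp
  moreover have "?P d \<longleftrightarrow> f (int d) < 0 \<and> 0 < f (int d + 1) \<or>
      (f (int d) < 0 \<longleftrightarrow> f (int d + 1) < 0) \<and> f (int d + 1) < f (int d)"
    using nz by (auto simp: zero_less_mult_iff mult_less_0_iff)
  ultimately show ?case
    unfolding Wmaj_Suc[OF Suc.hyps] using nz by (auto simp: add.commute[of 1])
qed

lemma weight_eq_des_weight:
  fixes s t :: "'a::comm_ring_1"
  assumes "1 \<le> d" and f: "\<And>i. i \<in> {1..int d} \<Longrightarrow> f i \<noteq> 0 \<and> \<bar>f i\<bar> \<le> int d"
  shows "s ^ beta d f * t ^ Wmaj d f =
    des_weight (\<lambda>i. s * t ^ i) (map (sign_rank d \<circ> f) [1..int d] @ [int d])"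
proof -
  let ?P = "\<lambda>i. f (int i) * f (int i + 1) * (f (int i) - f (int i + 1)) > 0"
  let ?u = "map (sign_rank d \<circ> f) [1..int d]"
  have len: "length ?u = d" by simp
  then have ne: "?u \<noteq> []" using assms(1) by (metis list.size(3) not_one_le_zero)
  have nth: "?u ! i = sign_rank d (f (int i + 1))" if "i < d" for i
    using that by (simp add: add.commute)
  have fd: "f (int d) \<noteq> 0 \<and> \<bar>f (int d)\<bar> \<le> int d" using f assms(1) by simp
  have last: "int d < last ?u \<longleftrightarrow> f (int d) < 0"
    unfolding last_conv_nth[OF ne] len using nth[of "d - 1"] assms(1) fd
    by (auto simp: sign_rank_def of_nat_diff)
  have "des_weight (\<lambda>i. s * t ^ i) ?u = (\<Prod>i=1..<d. if ?P i then s * t ^ i else 1)"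
    unfolding des_weight_def len
  proof (intro prod.cong refl)
    fix i assume i: "i \<in> {1..<d}"
    have "?u ! i < ?u ! (i - 1) \<longleftrightarrow> ?P i"
      using i nth[of i] nth[of "i - 1"] sign_rank_less_iff[of "f (int i)" "f (int i + 1)" d]
        f[of "int i"] f[of "int i + 1"] by (auto simp: of_nat_diff)
    then show "(if ?u ! i < ?u ! (i - 1) then s * t ^ i else 1) = (if ?P i then s * t ^ i else 1)"
      by simp
  qed
  also have "\<dots> = (\<Prod>i=1..<d. s ^ (if ?P i then 1 else 0)) * (\<Prod>i=1..<d. t ^ (if ?P i then i else 0))"
    unfolding prod.distrib[symmetric] by (intro prod.cong) auto
  also have "\<dots> = s ^ (\<Sum>i=1..<d. if ?P i then 1 else 0) * t ^ (\<Sum>i=1..<d. if ?P i then i else 0)"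
    by (simp only: power_sum)
  finally have "des_weight (\<lambda>i. s * t ^ i) ?u = \<dots>" .
  then show ?thesis
    unfolding des_weight_snoc[OF ne] last len beta_altdef
    using Wmaj_altdef[OF assms(1), of f] f by (simp add: power_add mult_ac)
qed

lemma Inv_eq_word_inv:
  assumes f: "\<And>i. i \<in> {1..int d} \<Longrightarrow> f i \<noteq> 0 \<and> \<bar>f i\<bar> \<le> int d" and "inj_on f {1..int d}"
  shows "Inv d f = word_inv (map (sign_rank d \<circ> f) [1..int d])"
proof -
  have "inj_on (sign_rank d \<circ> f) {1..int d}"
    using assms(2) by (rule comp_inj_on, intro inj_on_subset[OF inj_on_sign_rank]) (use f in force)
  then show ?thesis
    unfolding Inv_def
    by (subst word_inv_eq_card[symmetric])
      (use f in \<open>auto intro!: arg_cong[where f = card] simp: sign_rank_less_iff\<close>)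
qed

lemma bij_betw_words:
  assumes "card V = d"
    and C: "\<And>\<sigma>. \<sigma> \<in> C \<Longrightarrow> bij_betw \<sigma> {1..int d} V"
    and ext: "\<And>\<sigma> \<tau>. \<sigma> \<in> C \<Longrightarrow> \<tau> \<in> C \<Longrightarrow> \<forall>i\<in>{1..int d}. \<sigma> i = \<tau> i \<Longrightarrow> \<sigma> = \<tau>"
    and ex: "\<And>g. bij_betw g {1..int d} V \<Longrightarrow> \<exists>\<sigma>\<in>C. \<forall>i\<in>{1..int d}. \<sigma> i = g i"
  shows "bij_betw (\<lambda>\<sigma>. map \<sigma> [1..int d]) C (permutations_of_set V)"
  unfolding bij_betw_def
proof (intro conjI equalityI subsetI inj_onI)
  fix \<sigma> \<tau> assume "\<sigma> \<in> C" "\<tau> \<in> C" "map \<sigma> [1..int d] = map \<tau> [1..int d]"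
  then show "\<sigma> = \<tau>" by (intro ext) auto
next
  fix u assume "u \<in> (\<lambda>\<sigma>. map \<sigma> [1..int d]) ` C"
  then show "u \<in> permutations_of_set V"
    using C by (auto simp: bij_betw_def distinct_map intro!: permutations_of_setI)
next
  fix u assume u: "u \<in> permutations_of_set V"
  then have len: "length u = d" using assms(1) by (simp add: length_finite_permutations_of_set)
  define g where "g i = u ! nat (i - 1)" for i
  have "bij_betw (\<lambda>i. nat (i - 1)) {1..int d} {..<d}"
    by (rule bij_betw_byWitness[where f' = "\<lambda>n. int n + 1"]) auto
  moreover have "bij_betw ((!) u) {..<d} V"
    using u len by (intro bij_betw_nth) (auto dest: permutations_of_setD)
  ultimately have "bij_betw g {1..int d} V"
    unfolding g_def using bij_betw_trans by (fastforce simp: comp_def)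
  then obtain \<sigma> where \<sigma>: "\<sigma> \<in> C" "\<forall>i\<in>{1..int d}. \<sigma> i = g i" using ex by blast
  have "u = map \<sigma> [1..int d]"
    using \<sigma>(2) len by (intro nth_equalityI) (auto simp: g_def)
  then show "u \<in> (\<lambda>\<sigma>. map \<sigma> [1..int d]) ` C" using \<sigma>(1) by blast
qed

lemma M_A_eq_word_sum:
  assumes "1 \<le> d"
  shows "M_A d q s t = word_sum q (\<lambda>i. s * t ^ i) {1..int d}"
proof -
  have perm: "bij_betw \<sigma> {1..int d} {1..int d}" if "\<sigma> \<in> perms_A d" for \<sigma>
    using that by (simp add: perms_A_def permutes_imp_bij)
  have bij: "bij_betw (\<lambda>\<sigma>. map \<sigma> [1..int d]) (perms_A d) (permutations_of_set {1..int d})"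
  proof (rule bij_betw_words)
    fix \<sigma> \<tau> assume "\<sigma> \<in> perms_A d" "\<tau> \<in> perms_A d" and eq: "\<forall>i\<in>{1..int d}. \<sigma> i = \<tau> i"
    then have "\<sigma> i = i" "\<tau> i = i" if "i \<notin> {1..int d}" for i
      using that unfolding perms_A_def mem_Collect_eq by (meson permutes_not_in)+
    then show "\<sigma> = \<tau>" using eq by (intro ext) metis
  next
    fix g assume g: "bij_betw g {1..int d} {1..int d}"
    have "bij_betw (\<lambda>i. if i \<in> {1..int d} then g i else i) {1..int d} {1..int d}"
      using g by (subst bij_betw_cong[where g = g]) auto
    then have "(\<lambda>i. if i \<in> {1..int d} then g i else i) permutes {1..int d}"
      by (rule bij_imp_permutes) auto
    then show "\<exists>\<sigma>\<in>perms_A d. \<forall>i\<in>{1..int d}. \<sigma> i = g i"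
      unfolding perms_A_def by (intro bexI[of _ "\<lambda>i. if i \<in> {1..int d} then g i else i"]) auto
  qed (use perm in auto)
  have "q ^ len_A d \<sigma> * s ^ beta d \<sigma> * t ^ Wmaj d \<sigma> =
      q ^ word_inv (map \<sigma> [1..int d]) * des_weight (\<lambda>i. s * t ^ i) (map \<sigma> [1..int d])"
    if "\<sigma> \<in> perms_A d" for \<sigma>
  proof -
    have img: "\<sigma> i \<in> {1..int d}" if "i \<in> {1..int d}" for i
      using bij_betwE[OF perm[OF \<open>\<sigma> \<in> perms_A d\<close>]] that by blast
    then have f: "\<sigma> i \<noteq> 0 \<and> \<bar>\<sigma> i\<bar> \<le> int d" if "i \<in> {1..int d}" for i
      using img[OF that] by auto
    have m: "map (sign_rank d \<circ> \<sigma>) [1..int d] = map \<sigma> [1..int d]"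
      using img by (force simp: sign_rank_def)
    have ne: "map \<sigma> [1..int d] \<noteq> []" using assms by simp
    then have "\<not> int d < last (map \<sigma> [1..int d])"
      using last_in_set[OF ne] img by force
    then show ?thesis
      using weight_eq_des_weight[where f = \<sigma>, OF assms f, of s t]
        Inv_eq_word_inv[where f = \<sigma>, OF f] perm[OF that]
      unfolding m des_weight_snoc[OF ne] by (simp add: len_A_def bij_betw_def mult.assoc)
  qed
  then have "M_A d q s t = (\<Sum>\<sigma>\<in>perms_A d. q ^ word_inv (map \<sigma> [1..int d]) *
      des_weight (\<lambda>i. s * t ^ i) (map \<sigma> [1..int d]))"
    unfolding M_A_def by (intro sum.cong) auto
  also have "\<dots> = word_sum q (\<lambda>i. s * t ^ i) {1..int d}"
    unfolding word_sum_def by (rule sum.reindex_bij_betw[OF bij])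
  finally show ?thesis .
qed

definition neg_values :: "nat \<Rightarrow> (int \<Rightarrow> int) \<Rightarrow> int set" where
  "neg_values d \<sigma> = (\<lambda>i. - \<sigma> i) ` Neg d \<sigma>"

definition signed_set :: "nat \<Rightarrow> int set \<Rightarrow> int set" where
  "signed_set d N = ({1..int d} - N) \<union> uminus ` N"

lemma card_signed_set:
  assumes "N \<subseteq> {1..int d}"
  shows "card (signed_set d N) = d"
proof -
  have fin: "finite N" using assms by (rule finite_subset) simp
  have "card (signed_set d N) = card ({1..int d} - N) + card (uminus ` N)"
    unfolding signed_set_def using assms fin by (intro card_Un_disjoint) auto
  also have "\<dots> = d"
    using assms fin card_mono[OF _ assms] by (simp add: card_Diff_subset card_image)
  finally show ?thesis .
qed

lemma perms_BC_D:
  assumes "\<sigma> \<in> perms_BC d" "i \<in> {1..int d}"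
  shows "\<sigma> i \<noteq> 0" "\<bar>\<sigma> i\<bar> \<le> int d" "\<sigma> (- i) = - \<sigma> i"
proof -
  have "\<sigma> i \<in> {- int d..-1} \<union> {1..int d}"
    using assms permutes_in_image[of \<sigma> "{- int d..-1} \<union> {1..int d}" i]
    unfolding perms_BC_def by blast
  then show "\<sigma> i \<noteq> 0" "\<bar>\<sigma> i\<bar> \<le> int d" by auto
  show "\<sigma> (- i) = - \<sigma> i" using assms unfolding perms_BC_def by blast
qed

lemma inj_perms_BC: "\<sigma> \<in> perms_BC d \<Longrightarrow> inj \<sigma>"
  unfolding perms_BC_def by (auto intro: permutes_inj)

lemma neg_values_subset: "\<sigma> \<in> perms_BC d \<Longrightarrow> neg_values d \<sigma> \<subseteq> {1..int d}"
  using perms_BC_D by (fastforce simp: neg_values_def Neg_def)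

lemma bij_betw_signed_set:
  assumes "\<sigma> \<in> perms_BC d"
  shows "bij_betw \<sigma> {1..int d} (signed_set d (neg_values d \<sigma>))"
proof -
  have inj: "inj_on \<sigma> {1..int d}" using inj_perms_BC[OF assms] by (rule inj_on_subset) simp
  have "\<sigma> ` {1..int d} \<subseteq> signed_set d (neg_values d \<sigma>)"
  proof
    fix v assume "v \<in> \<sigma> ` {1..int d}"
    then obtain i where i: "i \<in> {1..int d}" "v = \<sigma> i" by auto
    show "v \<in> signed_set d (neg_values d \<sigma>)"
    proof (cases "v < 0")
      case True
      then have "- v \<in> neg_values d \<sigma>" using i by (auto simp: neg_values_def Neg_def)
      then show ?thesis by (force simp: signed_set_def)
    next
      case False
      have "v \<notin> neg_values d \<sigma>"
      proof
        assume "v \<in> neg_values d \<sigma>"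
        then obtain j where j: "j \<in> {1..int d}" "v = - \<sigma> j"
          by (auto simp: neg_values_def Neg_def)
        then have "\<sigma> i = \<sigma> (- j)" using i perms_BC_D(3)[OF assms j(1)] by simp
        then have "i = - j" using inj_perms_BC[OF assms] by (simp add: inj_eq)
        then show False using i j by auto
      qed
      then show ?thesis using False perms_BC_D[OF assms i(1)] i by (auto simp: signed_set_def)
    qed
  qed
  moreover have "card (\<sigma> ` {1..int d}) = card (signed_set d (neg_values d \<sigma>))"
    using card_signed_set[OF neg_values_subset[OF assms]] inj by (simp add: card_image)
  moreover have "finite (signed_set d (neg_values d \<sigma>))"
    using neg_values_subset[OF assms] finite_subset by (auto simp: signed_set_def)
  ultimately have "\<sigma> ` {1..int d} = signed_set d (neg_values d \<sigma>)"
    by (intro card_subset_eq) auto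
  then show ?thesis using inj by (simp add: bij_betw_def)
qed

lemma perms_BC_extension:
  assumes N: "N \<subseteq> {1..int d}" and g: "bij_betw g {1..int d} (signed_set d N)"
  shows "\<exists>\<sigma>\<in>perms_BC d. neg_values d \<sigma> = N \<and> (\<forall>i\<in>{1..int d}. \<sigma> i = g i)"
proof -
  define \<sigma> where "\<sigma> i = (if i \<in> {1..int d} then g i else if - i \<in> {1..int d} then - g (- i) else i)" for i
  let ?S = "{- int d..-1} \<union> {1..int d}"
  have gV: "g i \<in> signed_set d N" if "i \<in> {1..int d}" for i
    using g that by (auto simp: bij_betw_def)
  have VS: "signed_set d N \<subseteq> ?S" using N by (auto simp: signed_set_def)
  have Vopp: "- v \<notin> signed_set d N" if "v \<in> signed_set d N" for v
    using that subsetD[OF N, of v] subsetD[OF N, of "- v"] by (auto simp: signed_set_def)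
  have g_inj: "i = j" if "g i = g j" "i \<in> {1..int d}" "j \<in> {1..int d}" for i j
    using g that by (auto simp: bij_betw_def inj_on_def)
  have Scases: "i \<in> {1..int d} \<or> - i \<in> {1..int d} \<and> i \<notin> {1..int d}" if "i \<in> ?S" for i
    using that by auto
  have odd: "\<sigma> (- i) = - \<sigma> i" for i by (auto simp: \<sigma>_def)
  have \<sigma>S: "\<sigma> i \<in> ?S" if "i \<in> ?S" for i
  proof -
    have *: "\<sigma> j \<in> ?S" if "j \<in> {1..int d}" for j
      using gV[OF that] VS that unfolding \<sigma>_def by (simp only: if_True) blast
    from Scases[OF that] show ?thesis
    proof (elim disjE conjE)
      assume "- i \<in> {1..int d}"
      from *[OF this] show ?thesis unfolding odd by auto
    qed (rule *)
  qed
  have inj: "inj_on \<sigma> ?S"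
  proof (rule inj_onI)
    fix i j assume ij: "i \<in> ?S" "j \<in> ?S" "\<sigma> i = \<sigma> j"
    show "i = j"
      using Scases[OF ij(1)] Scases[OF ij(2)]
    proof (elim disjE conjE)
      assume "i \<in> {1..int d}" "j \<in> {1..int d}"
      then show ?thesis using ij(3) g_inj by (simp add: \<sigma>_def)
    next
      assume "i \<in> {1..int d}" "- j \<in> {1..int d}" "j \<notin> {1..int d}"
      then show ?thesis using ij(3) gV[of i] gV[of "- j"] Vopp[of "g (- j)"] by (simp add: \<sigma>_def)
    next
      assume "j \<in> {1..int d}" "- i \<in> {1..int d}" "i \<notin> {1..int d}"
      then show ?thesis using ij(3) gV[of j] gV[of "- i"] Vopp[of "g (- i)"] by (simp add: \<sigma>_def)
    next
      assume "- i \<in> {1..int d}" "i \<notin> {1..int d}" "- j \<in> {1..int d}" "j \<notin> {1..int d}"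
      then show ?thesis using ij(3) g_inj[of "- i" "- j"] by (simp add: \<sigma>_def)
    qed
  qed
  have "\<sigma> ` ?S \<subseteq> ?S" using \<sigma>S by (rule image_subsetI)
  then have "bij_betw \<sigma> ?S ?S"
    unfolding bij_betw_def using inj by (intro conjI endo_inj_surj) auto
  then have "\<sigma> permutes ?S" by (rule bij_imp_permutes) (auto simp: \<sigma>_def)
  then have mem: "\<sigma> \<in> perms_BC d" using odd by (simp add: perms_BC_def)
  have "Neg d \<sigma> = {i \<in> {1..int d}. g i < 0}" by (auto simp: Neg_def \<sigma>_def)
  then have "neg_values d \<sigma> = (\<lambda>i. - g i) ` {i \<in> {1..int d}. g i < 0}"
    by (auto simp: neg_values_def \<sigma>_def)
  also have "\<dots> = uminus ` {v \<in> g ` {1..int d}. v < 0}" by auto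
  also have "g ` {1..int d} = signed_set d N" using g by (simp add: bij_betw_def)
  also have "{v \<in> signed_set d N. v < 0} = uminus ` N" using N by (auto simp: signed_set_def)
  finally have "neg_values d \<sigma> = N" by (simp add: image_image)
  then show ?thesis using mem by (intro bexI[of _ \<sigma>]) (auto simp: \<sigma>_def)
qed

lemma bij_betw_words_signed:
  assumes N: "N \<subseteq> {1..int d}"
  shows "bij_betw (\<lambda>\<sigma>. map \<sigma> [1..int d]) {\<sigma> \<in> perms_BC d. neg_values d \<sigma> = N}
    (permutations_of_set (signed_set d N))"
proof (rule bij_betw_words)
  fix \<sigma> \<tau> assume *: "\<sigma> \<in> {\<sigma> \<in> perms_BC d. neg_values d \<sigma> = N}" "\<tau> \<in> {\<sigma> \<in> perms_BC d. neg_values d \<sigma> = N}"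
    and eq: "\<forall>i\<in>{1..int d}. \<sigma> i = \<tau> i"
  show "\<sigma> = \<tau>"
  proof
    fix i
    consider "i \<in> {1..int d}" | "- i \<in> {1..int d}" | "i \<notin> {- int d..-1} \<union> {1..int d}"
      by fastforce
    then show "\<sigma> i = \<tau> i"
    proof cases
      case 2
      then show ?thesis using * eq perms_BC_D(3)[of \<sigma> d "- i"] perms_BC_D(3)[of \<tau> d "- i"] by simp
    next
      case 3
      have "\<sigma> permutes ({- int d..-1} \<union> {1..int d})" "\<tau> permutes ({- int d..-1} \<union> {1..int d})"
        using * by (simp_all add: perms_BC_def)
      then show ?thesis using 3 permutes_not_in by metis
    qed (use eq in auto)
  qed
next
  fix g assume "bij_betw g {1..int d} (signed_set d N)"
  from perms_BC_extension[OF N this]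
  show "\<exists>\<sigma>\<in>{\<sigma> \<in> perms_BC d. neg_values d \<sigma> = N}. \<forall>i\<in>{1..int d}. \<sigma> i = g i" by blast
qed (use bij_betw_signed_set card_signed_set[OF N] in auto)

section \<open>The recurrences\<close>

lemma sum_signed_fibre:
  fixes q s t :: "'a::comm_ring_1"
  assumes "1 \<le> d" and N: "N \<subseteq> {1..int d}"
  shows "(\<Sum>\<sigma> | \<sigma> \<in> perms_BC d \<and> neg_values d \<sigma> = N.
      y (card (Neg d \<sigma>)) * (q ^ len_D d \<sigma> * s ^ beta d \<sigma> * t ^ Wmaj d \<sigma>)) =
    y (card N) * q ^ (\<Sum>n\<in>N. nat (int d - n)) *
    (\<Sum>u\<in>permutations_of_set (({1..int d} - N) \<union> (\<lambda>n. 2 * int d + 1 - n) ` N).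
      q ^ word_inv u * des_weight (\<lambda>i. s * t ^ i) (u @ [int d]))"
proof -
  let ?C = "{\<sigma>. \<sigma> \<in> perms_BC d \<and> neg_values d \<sigma> = N}"
  let ?V = "signed_set d N"
  let ?F = "\<lambda>u. q ^ word_inv u * des_weight (\<lambda>i. s * t ^ i) (u @ [int d])"
  have "y (card (Neg d \<sigma>)) * (q ^ len_D d \<sigma> * s ^ beta d \<sigma> * t ^ Wmaj d \<sigma>) =
      y (card N) * q ^ (\<Sum>n\<in>N. nat (int d - n)) * ?F (map (sign_rank d) (map \<sigma> [1..int d]))"
    if "\<sigma> \<in> ?C" for \<sigma>
  proof -
    have \<sigma>: "\<sigma> \<in> perms_BC d" and N': "N = (\<lambda>i. - \<sigma> i) ` Neg d \<sigma>"
      using that by (auto simp: neg_values_def)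
    have f: "\<sigma> i \<noteq> 0 \<and> \<bar>\<sigma> i\<bar> \<le> int d" if "i \<in> {1..int d}" for i
      using perms_BC_D[OF \<sigma> that] by simp
    have inj: "inj_on (\<lambda>i. - \<sigma> i) A" for A
      using inj_perms_BC[OF \<sigma>] by (auto simp: inj_on_def)
    have "inj_on \<sigma> {1..int d}" using inj_perms_BC[OF \<sigma>] by (rule inj_on_subset) simp
    note Inv_eq_word_inv[where f = \<sigma>, OF f this]
    moreover have "card (Neg d \<sigma>) = card N"
      unfolding N' by (rule card_image[OF inj, symmetric])
    moreover have "(\<Sum>i\<in>Neg d \<sigma>. nat (int d + \<sigma> i)) = (\<Sum>n\<in>N. nat (int d - n))"
      unfolding N' sum.reindex[OF inj] by simp
    ultimately have "q ^ len_D d \<sigma> = q ^ word_inv (map (sign_rank d \<circ> \<sigma>) [1..int d]) *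
        q ^ (\<Sum>n\<in>N. nat (int d - n))"
      and "card (Neg d \<sigma>) = card N" by (simp_all add: len_D_def power_add)
    then show ?thesis
      using weight_eq_des_weight[where f = \<sigma>, OF assms(1) f, of s t]
      by (simp only: mult.assoc map_map) (simp only: mult_ac)
  qed
  then have "(\<Sum>\<sigma> | \<sigma> \<in> perms_BC d \<and> neg_values d \<sigma> = N.
      y (card (Neg d \<sigma>)) * (q ^ len_D d \<sigma> * s ^ beta d \<sigma> * t ^ Wmaj d \<sigma>)) =
    y (card N) * q ^ (\<Sum>n\<in>N. nat (int d - n)) *
      (\<Sum>\<sigma>\<in>?C. ?F (map (sign_rank d) (map \<sigma> [1..int d])))"
    unfolding sum_distrib_left by (intro sum.cong refl) blast
  also have "(\<Sum>\<sigma>\<in>?C. ?F (map (sign_rank d) (map \<sigma> [1..int d]))) =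
      (\<Sum>u\<in>permutations_of_set ?V. ?F (map (sign_rank d) u))"
    by (rule sum.reindex_bij_betw[OF bij_betw_words_signed[OF N]])
  also have "\<dots> = (\<Sum>u\<in>map (sign_rank d) ` permutations_of_set ?V. ?F u)"
  proof (subst sum.reindex)
    have V: "?V \<subseteq> {- int d..int d}" using N by (auto simp: signed_set_def)
    show "inj_on (map (sign_rank d)) (permutations_of_set ?V)"
    proof (rule inj_onI)
      fix u v assume "u \<in> permutations_of_set ?V" "v \<in> permutations_of_set ?V"
        and eq: "map (sign_rank d) u = map (sign_rank d) v"
      then have "set u \<union> set v = ?V" by (simp add: permutations_of_setD(1))
      then show "u = v" using eq inj_on_subset[OF inj_on_sign_rank V] by (simp add: map_inj_on)
    qed
  qed simp
  also have "map (sign_rank d) ` permutations_of_set ?V = permutations_of_set (sign_rank d ` ?V)"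
    using N by (intro permutations_of_set_image_inj[symmetric] inj_on_subset[OF inj_on_sign_rank])
      (auto simp: signed_set_def)
  also have "sign_rank d ` ?V = ({1..int d} - N) \<union> (\<lambda>n. 2 * int d + 1 - n) ` N"
  proof -
    have "sign_rank d ` ({1..int d} - N) = {1..int d} - N"
      by (force simp: sign_rank_def image_iff)
    moreover have "sign_rank d ` uminus ` N = (\<lambda>n. 2 * int d + 1 - n) ` N"
      unfolding image_image using N by (intro image_cong) (auto simp: sign_rank_def)
    ultimately show ?thesis unfolding signed_set_def image_Un by simp
  qed
  finally show ?thesis .
qed

lemma sum_subsets_by_card:
  fixes f :: "nat \<Rightarrow> 'a::semiring_0"
  assumes "finite A"
  shows "(\<Sum>N\<in>Pow A. f (card N) * g N) = (\<Sum>m\<le>card A. f m * (\<Sum>N | N \<subseteq> A \<and> card N = m. g N))"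
proof -
  have "(\<Sum>N\<in>Pow A. f (card N) * g N) = (\<Sum>m\<le>card A. \<Sum>N | N \<in> Pow A \<and> card N = m. f (card N) * g N)"
    using assms by (intro sum.group[symmetric]) (auto intro: card_mono)
  also have "\<dots> = (\<Sum>m\<le>card A. f m * (\<Sum>N | N \<subseteq> A \<and> card N = m. g N))"
    by (intro sum.cong refl) (auto simp: sum_distrib_left)
  finally show ?thesis .
qed

text \<open>The weight \<open>y\<close> of the number of negative values covers both types: \<open>y m = q ^ m\<close> turns
  \<^const>\<open>len_D\<close> into \<^const>\<open>len_BC\<close>, and the indicator of even \<open>m\<close> selects \<^const>\<open>perms_D\<close>.\<close>

lemma signed_sum_rec:
  fixes q s t :: "'a::comm_ring_1"
  assumes "1 \<le> d"
  shows "(\<Sum>\<sigma>\<in>perms_BC d. y (card (Neg d \<sigma>)) * (q ^ len_D d \<sigma> * s ^ beta d \<sigma> * t ^ Wmaj d \<sigma>)) =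
    y 0 * (\<Prod>j=1..d. 1 - s * t ^ j) +
    s * (\<Sum>k=1..d. t ^ k * qbinom q d k *
      (\<Sum>m\<le>k. y m * (qbinom q k m * q ^ (m choose 2) * q ^ (m * (d - k)))) *
      (\<Prod>j=k+1..d. 1 - s * t ^ j) * M_A k q s t)"
proof -
  let ?w = "\<lambda>\<sigma>. y (card (Neg d \<sigma>)) * (q ^ len_D d \<sigma> * s ^ beta d \<sigma> * t ^ Wmaj d \<sigma>)"
  let ?x = "\<lambda>i. s * t ^ i"
  let ?W = "\<lambda>k. word_sum q ?x {1..int k}"
  define H where "H m k = (if m \<le> k then q ^ (m * (d - k)) * qbinom q (d - m) (k - m) else 0)" for m k
  define F where "F m = (if m = 0 then \<Prod>i=1..d. 1 - ?x i else 0) +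
    (\<Sum>k=1..d. ?x k * (\<Prod>i=k+1..d. 1 - ?x i) * (H m k * ?W k))" for m
  have fibre: "(\<Sum>\<sigma> | \<sigma> \<in> perms_BC d \<and> neg_values d \<sigma> = N. ?w \<sigma>) =
      (y (card N) * F (card N)) * q ^ (\<Sum>n\<in>N. nat (int d - n))" if N: "N \<subseteq> {1..int d}" for N
  proof -
    let ?L = "{1..int d} - N" and ?B = "(\<lambda>n. 2 * int d + 1 - n) ` N"
    have fin: "finite N" using N by (rule finite_subset) simp
    have cN: "card N \<le> d" using card_mono[OF _ N] by simp
    have cB: "card ?B = card N" by (rule card_image) (simp add: inj_on_def)
    have cL: "card ?L = d - card N" using N fin by (simp add: card_Diff_subset)
    have B: "\<forall>v\<in>?B. int d < v" using N by auto
    have cT: "card (?L \<union> ?B) = d"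
      using B fin cL cB cN by (subst card_Un_disjoint) force+
    have "(\<forall>v\<in>?L \<union> ?B. v \<le> int d) \<longleftrightarrow> card N = 0"
      using B fin by force
    moreover have "(\<Sum>U | U \<subseteq> ?L \<union> ?B \<and> card U = k \<and> (\<forall>v\<in>?L \<union> ?B - U. v \<le> int d).
        q ^ cross_inv U (?L \<union> ?B - U)) = H (card N) k" for k
      using sum_cross_inv_threshold[of ?L ?B "int d" q k] fin B cN
      unfolding cL cB H_def by simp
    ultimately have "(\<Sum>u\<in>permutations_of_set (?L \<union> ?B). q ^ word_inv u * des_weight ?x (u @ [int d])) = F (card N)"
      using word_sum_threshold_rec[of "?L \<union> ?B" q ?x "int d"] fin unfolding F_def cT by simp
    then show ?thesis
      unfolding sum_signed_fibre[OF assms N] by (simp add: mult_ac)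
  qed
  have fin: "finite (perms_BC d)"
    unfolding perms_BC_def by (rule finite_subset[OF _ finite_permutations]) auto
  have "(\<Sum>\<sigma>\<in>perms_BC d. ?w \<sigma>) =
      (\<Sum>N\<in>Pow {1..int d}. \<Sum>\<sigma> | \<sigma> \<in> perms_BC d \<and> neg_values d \<sigma> = N. ?w \<sigma>)"
    using fin neg_values_subset by (intro sum.group[symmetric]) auto
  also have "\<dots> = (\<Sum>N\<in>Pow {1..int d}. (y (card N) * F (card N)) * q ^ (\<Sum>n\<in>N. nat (int d - n)))"
    by (intro sum.cong refl fibre) auto
  also have "\<dots> = (\<Sum>m\<le>d. y m * F m * (q ^ (m choose 2) * qbinom q d m))"
    by (subst sum_subsets_by_card[where f = "\<lambda>m. y m * F m"]) (simp_all add: sum_subsets_codegree)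
  also have "\<dots> = (\<Sum>m\<le>d. if m = 0 then y 0 * (\<Prod>i=1..d. 1 - ?x i) else 0) +
    (\<Sum>m\<le>d. \<Sum>k=1..d. ?x k * (\<Prod>i=k+1..d. 1 - ?x i) * ?W k *
      (y m * H m k * (q ^ (m choose 2) * qbinom q d m)))"
    unfolding sum.distrib[symmetric]
    by (intro sum.cong refl) (auto simp: F_def sum_distrib_left sum_distrib_right algebra_simps numeral_2_eq_2)
  also have "\<dots> = y 0 * (\<Prod>i=1..d. 1 - ?x i) + (\<Sum>k=1..d. ?x k * (\<Prod>i=k+1..d. 1 - ?x i) * ?W k *
      (\<Sum>m\<le>d. y m * H m k * (q ^ (m choose 2) * qbinom q d m)))"
    by (subst sum.swap) (simp add: sum_distrib_left)
  also have "\<dots> = y 0 * (\<Prod>j=1..d. 1 - s * t ^ j) +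
    s * (\<Sum>k=1..d. t ^ k * qbinom q d k *
      (\<Sum>m\<le>k. y m * (qbinom q k m * q ^ (m choose 2) * q ^ (m * (d - k)))) *
      (\<Prod>j=k+1..d. 1 - s * t ^ j) * M_A k q s t)"
    unfolding sum_distrib_left[of s]
  proof (intro arg_cong2[where f = "(+)"] sum.cong refl)
    fix k assume k: "k \<in> {1..d}"
    have "(\<Sum>m\<le>d. y m * H m k * (q ^ (m choose 2) * qbinom q d m)) =
        (\<Sum>m\<le>k. y m * (q ^ (m * (d - k)) * qbinom q (d - m) (k - m)) * (q ^ (m choose 2) * qbinom q d m))"
      using k by (intro sum.mono_neutral_cong_right) (auto simp: H_def)
    also have "\<dots> = (\<Sum>m\<le>k. qbinom q d k * (y m * (qbinom q k m * q ^ (m choose 2) * q ^ (m * (d - k)))))"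
    proof (intro sum.cong refl)
      fix m assume "m \<in> {..k}"
      then have "qbinom q d m * qbinom q (d - m) (k - m) = qbinom q d k * qbinom q k m"
        using k by (intro qbinom_trinomial_revision[symmetric]) auto
      then have "y m * q ^ (m * (d - k)) * q ^ (m choose 2) * (qbinom q d m * qbinom q (d - m) (k - m)) =
        y m * q ^ (m * (d - k)) * q ^ (m choose 2) * (qbinom q d k * qbinom q k m)" by simp
      then show "y m * (q ^ (m * (d - k)) * qbinom q (d - m) (k - m)) * (q ^ (m choose 2) * qbinom q d m) =
        qbinom q d k * (y m * (qbinom q k m * q ^ (m choose 2) * q ^ (m * (d - k))))"
        by (simp only: mult_ac)
    qed
    finally show "?x k * (\<Prod>i=k+1..d. 1 - ?x i) * ?W k *
        (\<Sum>m\<le>d. y m * H m k * (q ^ (m choose 2) * qbinom q d m)) =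
      s * (t ^ k * qbinom q d k *
      (\<Sum>m\<le>k. y m * (qbinom q k m * q ^ (m choose 2) * q ^ (m * (d - k)))) *
      (\<Prod>j=k+1..d. 1 - s * t ^ j) * M_A k q s t)"
      using k unfolding sum_distrib_left[symmetric] by (simp add: M_A_eq_word_sum mult_ac)
  qed
  finally show ?thesis .
qed

lemma M_A_rec:
  fixes q s t :: "'a::comm_ring_1"
  assumes "1 \<le> d"
  shows "M_A d q s t = (\<Prod>j=1..d-1. 1 - s * t ^ j) +
    s * (\<Sum>k=1..d-1. t ^ k * qbinom q d k * (\<Prod>j=k+1..d-1. 1 - s * t ^ j) * M_A k q s t)"
proof -
  have "M_A d q s t = (\<Prod>i=1..d-1. 1 - s * t ^ i) + (\<Sum>k=1..d-1. s * t ^ k *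
      (\<Prod>i=k+1..d-1. 1 - s * t ^ i) * (qbinom q d k * word_sum q (\<lambda>i. s * t ^ i) {1..int k}))"
    using word_sum_rec[of "{1..int d}" "d - 1" q "\<lambda>i. s * t ^ i"] assms
    by (simp add: M_A_eq_word_sum)
  then show ?thesis
    unfolding sum_distrib_left by (simp add: M_A_eq_word_sum mult_ac)
qed

lemma len_BC_eq: "\<sigma> \<in> perms_BC d \<Longrightarrow> len_BC d \<sigma> = card (Neg d \<sigma>) + len_D d \<sigma>"
proof -
  assume \<sigma>: "\<sigma> \<in> perms_BC d"
  have "nat (int d + 1 + \<sigma> i) = Suc (nat (int d + \<sigma> i))" if "i \<in> Neg d \<sigma>" for i
    using perms_BC_D(2)[OF \<sigma>, of i] that by (auto simp: Neg_def)
  then show ?thesis by (simp add: len_BC_def len_D_def sum_Suc)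
qed

lemma M_BC_rec:
  fixes q s t :: "'a::field"
  assumes "1 \<le> d" and q: "\<And>n. 1 \<le> n \<Longrightarrow> q ^ n \<noteq> 1"
  shows "M_BC d q s t = (\<Prod>j=1..d. 1 - s * t ^ j) +
    s * (\<Sum>k=1..d. t ^ k * (\<Prod>j=0..k-1. (1 - q ^ (2 * d - 2 * j)) / (1 - q ^ (k - j))) *
      (\<Prod>j=k+1..d. 1 - s * t ^ j) * M_A k q s t)"
proof -
  have coeff: "qbinom q d k * (\<Sum>m\<le>k. q ^ m * (qbinom q k m * q ^ (m choose 2) * q ^ (m * (d - k)))) =
      (\<Prod>j=0..k-1. (1 - q ^ (2 * d - 2 * j)) / (1 - q ^ (k - j)))" if k: "k \<in> {1..d}" for k
  proof -
    have "(\<Sum>m\<le>k. q ^ m * (qbinom q k m * q ^ (m choose 2) * q ^ (m * (d - k)))) =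
        (\<Sum>m\<le>k. qbinom q k m * q ^ (m choose 2) * (q ^ Suc (d - k)) ^ m)"
    proof (intro sum.cong refl)
      fix m
      have "q ^ m * q ^ (m * (d - k)) = (q ^ Suc (d - k)) ^ m"
        by (simp add: power_mult power_mult_distrib mult.commute[of m])
      then show "q ^ m * (qbinom q k m * q ^ (m choose 2) * q ^ (m * (d - k))) =
          qbinom q k m * q ^ (m choose 2) * (q ^ Suc (d - k)) ^ m"
        by (simp add: mult_ac)
    qed
    also have "\<dots> = (\<Prod>j<k. 1 + q ^ Suc (d - k) * q ^ j)" by (rule q_binomial_theorem)
    also have "\<dots> = (\<Prod>j<k. 1 + q ^ Suc (d - k) * q ^ (k - Suc j))"
      by (rule prod.nat_diff_reindex[symmetric])
    also have "\<dots> = (\<Prod>j<k. 1 + q ^ (d - j))"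
    proof (intro prod.cong refl)
      fix j assume "j \<in> {..<k}"
      then have "Suc (d - k) + (k - Suc j) = d - j" using k by auto
      then show "1 + q ^ Suc (d - k) * q ^ (k - Suc j) = 1 + q ^ (d - j)"
        unfolding power_add[symmetric] by (simp only:)
    qed
    finally have S: "(\<Sum>m\<le>k. q ^ m * (qbinom q k m * q ^ (m choose 2) * q ^ (m * (d - k)))) =
      (\<Prod>j<k. 1 + q ^ (d - j))" .
    have nz: "1 - q ^ (k - j) \<noteq> 0" if "j < k" for j using q[of "k - j"] that by simp
    then have "(\<Prod>j<k. 1 - q ^ (k - j)) \<noteq> 0" by simp
    then have b: "qbinom q d k = (\<Prod>j<k. 1 - q ^ (d - j)) / (\<Prod>j<k. 1 - q ^ (k - j))"
      using qbinom_times_prod[of k d q] k by (simp add: eq_divide_eq)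
    have I: "{0..k-1} = {..<k}" using k by auto
    have sq: "1 - q ^ (2 * d - 2 * j) = (1 - q ^ (d - j)) * (1 + q ^ (d - j))" for j
    proof -
      have "q ^ (2 * d - 2 * j) = q ^ (d - j) * q ^ (d - j)"
        unfolding power_add[symmetric] by (rule arg_cong[where f = "power q"]) simp
      then show ?thesis by (simp add: algebra_simps)
    qed
    show ?thesis
      unfolding S b I sq by (simp add: prod_dividef prod.distrib)
  qed
  have "M_BC d q s t = (\<Sum>\<sigma>\<in>perms_BC d. q ^ card (Neg d \<sigma>) * (q ^ len_D d \<sigma> * s ^ beta d \<sigma> * t ^ Wmaj d \<sigma>))"
    unfolding M_BC_def by (intro sum.cong refl) (simp add: len_BC_eq power_add mult_ac)
  also have "\<dots> = (\<Prod>j=1..d. 1 - s * t ^ j) +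
    s * (\<Sum>k=1..d. t ^ k * (qbinom q d k * (\<Sum>m\<le>k. q ^ m * (qbinom q k m * q ^ (m choose 2) * q ^ (m * (d - k))))) *
      (\<Prod>j=k+1..d. 1 - s * t ^ j) * M_A k q s t)"
    using signed_sum_rec[OF assms(1), of "\<lambda>m. q ^ m" q s t] by (simp add: mult.assoc)
  finally show ?thesis by (simp only: coeff cong: sum.cong)
qed

lemma M_D_rec:
  fixes q s t :: "'a::comm_ring_1"
  assumes "1 \<le> d"
  shows "M_D d q s t = (\<Prod>j=1..d. 1 - s * t ^ j) +
    s * (\<Sum>k=1..d. t ^ k * qbinom q d k *
      (\<Sum>l=0..k div 2. qbinom q k (2 * l) * q ^ (l * (2 * d + 2 * l - 2 * k - 1))) *
      (\<Prod>j=k+1..d. 1 - s * t ^ j) * M_A k q s t)"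
proof -
  let ?y = "\<lambda>m. if even m then 1 else 0 :: 'a"
  have coeff: "(\<Sum>m\<le>k. ?y m * (qbinom q k m * q ^ (m choose 2) * q ^ (m * (d - k)))) =
      (\<Sum>l=0..k div 2. qbinom q k (2 * l) * q ^ (l * (2 * d + 2 * l - 2 * k - 1)))" if k: "k \<in> {1..d}" for k
  proof -
    have ex: "(2 * l choose 2) + 2 * l * (d - k) = l * (2 * d + 2 * l - 2 * k - 1)" for l
    proof (cases l)
      case (Suc l')
      have "2 * d + 2 * l - 2 * k - 1 = 2 * (d - k) + (2 * l - 1)" using k Suc by auto
      moreover have "2 * l choose 2 = l * (2 * l - 1)" by (simp add: choose_two)
      ultimately show ?thesis by (simp add: algebra_simps)
    qed (simp add: numeral_2_eq_2)
    have "(\<Sum>m\<le>k. ?y m * (qbinom q k m * q ^ (m choose 2) * q ^ (m * (d - k)))) =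
        (\<Sum>m\<in>(\<lambda>l. 2 * l) ` {0..k div 2}. qbinom q k m * q ^ (m choose 2) * q ^ (m * (d - k)))"
      by (rule sum.mono_neutral_cong_right) (auto elim!: evenE)
    also have "\<dots> = (\<Sum>l=0..k div 2. qbinom q k (2 * l) * q ^ ((2 * l choose 2) + 2 * l * (d - k)))"
      by (subst sum.reindex) (auto simp: inj_on_def power_add mult.assoc)
    finally show ?thesis unfolding ex .
  qed
  have fin: "finite (perms_BC d)"
    unfolding perms_BC_def by (rule finite_subset[OF _ finite_permutations]) auto
  have "M_D d q s t = (\<Sum>\<sigma>\<in>perms_BC d. ?y (card (Neg d \<sigma>)) * (q ^ len_D d \<sigma> * s ^ beta d \<sigma> * t ^ Wmaj d \<sigma>))"
    unfolding M_D_def perms_D_def using fin by (intro sum.mono_neutral_cong_left) auto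
  also have "\<dots> = (\<Prod>j=1..d. 1 - s * t ^ j) +
    s * (\<Sum>k=1..d. t ^ k * qbinom q d k * (\<Sum>m\<le>k. ?y m * (qbinom q k m * q ^ (m choose 2) * q ^ (m * (d - k)))) *
      (\<Prod>j=k+1..d. 1 - s * t ^ j) * M_A k q s t)"
    by (subst signed_sum_rec[OF assms]) simp
  finally show ?thesis by (simp only: coeff cong: sum.cong)
qed

lemma var_q_power_neq_1:
  assumes "1 \<le> n"
  shows "var_q ^ n \<noteq> 1"
proof
  let ?p = "[:[:[:0, 1:]:]:] :: int poly poly poly"
  assume "var_q ^ n = 1"
  moreover have "to_fract (?p ^ n) = to_fract ?p ^ n"
    by (induction n) (simp_all only: power_0 power_Suc to_fract_1 to_fract_mult)
  ultimately have "to_fract (?p ^ n) = to_fract 1" by (simp add: var_q_def)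
  then have "?p ^ n = 1" by (simp only: to_fract_eq_iff)
  then have "poly (poly (poly (?p ^ n) 0) 0) (2::int) = 1" by simp
  then have "(2::int) ^ n = 1" by (simp only: poly_power) simp
  then show False using assms by simp
qed

theorem theorem19p2:
  fixes d :: nat and q s t :: ratfun
  assumes "d \<ge> 1"
    and "q = var_q" and "s = var_s" and "t = var_t"
  shows
    "M_A d q s t =
       (\<Prod>j=1..d-1. 1 - s * t ^ j) +
       s * (\<Sum>k=1..d-1. t ^ k * qbinom q d k * (\<Prod>j=k+1..d-1. 1 - s * t ^ j) * M_A k q s t) \<and>
     M_BC d q s t =
       (\<Prod>j=1..d. 1 - s * t ^ j) +
       s * (\<Sum>k=1..d. t ^ k *
              (\<Prod>j=0..k-1. (1 - q ^ (2 * d - 2 * j)) / (1 - q ^ (k - j))) *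
              (\<Prod>j=k+1..d. 1 - s * t ^ j) * M_A k q s t) \<and>
     M_D d q s t =
       (\<Prod>j=1..d. 1 - s * t ^ j) +
       s * (\<Sum>k=1..d. t ^ k * qbinom q d k *
              (\<Sum>l=0..k div 2. qbinom q k (2 * l) * q ^ (l * (2 * d + 2 * l - 2 * k - 1))) *
              (\<Prod>j=k+1..d. 1 - s * t ^ j) * M_A k q s t)"
  unfolding assms(2-4)
  using M_A_rec[OF assms(1)] M_BC_rec[OF assms(1) var_q_power_neq_1] M_D_rec[OF assms(1)]
  by blast

end
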